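(* Let $\beta\in(0,1]$, $\xi,\varphi\in L_1(\mathbb{R}_+)$ and $h\in L_1^{0,\beta}(\mathbb{R}_+)$ be given, and consider the integral equation for the unknown function $f$ $$f(x)+(f\underset{1}{\ast}\varphi)(x)=\underset{F_s,F_c,K}{\ast}(\xi,\varphi,h)(x),\quad x>0.$$ If $1+(F_c\varphi)(y)\neq0$ for all $y>0$, then this equation is solvable in $L_1(\mathbb{R}_+)$. Moreover, its solution $f\in L_1(\mathbb{R}_+)$ is unique and is given almost everywhere in $\mathbb{R}_+$ by $$f(x)=\underset{F_s,F_c,K}{\ast}(\xi,\ell,h)(x)=\big[(\xi\underset{1}{\ast}\ell)\underset{2}{\ast}h\big](x),$$ where $\ell\in L_1(\mathbb{R}_+)$ is the function determined by $$(F_c\ell)(y)=\frac{(F_c\varphi)(y)}{1+(F_c\varphi)(y)},\quad y>0.$$ Finally, $$\|f\|_{L_1(\mathbb{R}_+)}\le\sqrt{\tfrac2\pi}\,\|\xi\|_{L_1(\mathbb{R}_+)}\,\|\ell\|_{L_1(\mathbb{R}_+)}\,\|h\|_{L_1^{0,\beta}(\mathbb{R}_+)}.$$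
   Context: $\mathbb{R}_+=[0,\infty)$. The polyconvolution of $f,g,h$ is $$\underset{F_s,F_c,K}{\ast}(f,g,h)(x):=\frac{1}{2\sqrt{2\pi}}\int_{\mathbb{R}_+^3}\Phi(x,u,v,w)f(u)g(v)h(w)\,du\,dv\,dw,\quad x>0,$$ $$\Phi(x,u,v,w)=e^{-w\cosh(x-u+v)}+e^{-w\cosh(x-u-v)}-e^{-w\cosh(x+u+v)}-e^{-w\cosh(x+u-v)}.$$ Sneddon's convolution: $(f\underset{1}{\ast}g)(x)=\frac{1}{\sqrt{2\pi}}\int_0^\infty f(u)\big[g(|x-u|)-g(x+u)\big]\,du$, $x>0$. Yakubovich–Britvina's convolution: $(f\underset{2}{\ast}g)(x)=\frac12\int_{\mathbb{R}_+^2}\big[e^{-u\cosh(v-x)}-e^{-u\cosh(v+x)}\big]f(v)g(u)\,du\,dv$, $x>0$. Fourier cosine transform: $(F_cf)(y)=\sqrt{2/\pi}\int_0^\infty\cos(xy)f(x)\,dx$, $y>0$. $K_0(x)=\int_0^\infty e^{-x\cosh t}\,dt$, and $L_1^{0,\beta}(\mathbb{R}_+)$ is the space of functions $h$ on $\mathbb{R}_+$ with $\|h\|_{L_1^{0,\beta}(\mathbb{R}_+)}=\int_0^\infty|h(x)|K_0(\beta x)\,dx<\infty$.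
   Formalization: The condition 1+(F_cφ)(y)≠0 is also required at y=0; without it no ℓ in L_1 exists, e.g. φ(x)=-√(π/2)e^{-x} would need (F_cℓ)(y)=-1/y², which is unbounded. *)

theory Defs
  imports "HOL-Analysis.Analysis"
begin

text \<open>
  Functions on the half-line $[0,\infty)$ are represented by functions of type
  \<^typ>\<open>real \<Rightarrow> complex\<close>, of which only the values on \<^term>\<open>{0::real..}\<close> are ever used. All
  integrals are Lebesgue integrals; two functions represent the same element of $L_1$ when they
  agree almost everywhere on the half-line.
\<close>

definition L1 :: "(real \<Rightarrow> complex) set" where
  "L1 = {f. f absolutely_integrable_on {0..}}"

definition L1_norm :: "(real \<Rightarrow> complex) \<Rightarrow> real" where
  "L1_norm f = (LINT x:{0..}|lebesgue. norm (f x))"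

text \<open>The integral defining \<open>K0 x\<close> converges for \<open>x > 0\<close> only; in the weighted space below the value
  at \<open>0\<close> is irrelevant, because it is used on a null set.\<close>

definition K0 :: "real \<Rightarrow> real" where
  "K0 x = (LINT t:{0..}|lebesgue. exp (- x * cosh t))"

definition L1_weighted :: "real \<Rightarrow> (real \<Rightarrow> complex) set" where
  "L1_weighted \<beta> = {h. set_borel_measurable lebesgue {0..} h \<and>
     set_integrable lebesgue {0..} (\<lambda>x. norm (h x) * K0 (\<beta> * x))}"

definition L1_weighted_norm :: "real \<Rightarrow> (real \<Rightarrow> complex) \<Rightarrow> real" where
  "L1_weighted_norm \<beta> h = (LINT x:{0..}|lebesgue. norm (h x) * K0 (\<beta> * x))"

definition fourier_cos :: "(real \<Rightarrow> complex) \<Rightarrow> real \<Rightarrow> complex" where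
  "fourier_cos f y =
     of_real (sqrt (2 / pi)) * (LINT x:{0..}|lebesgue. of_real (cos (x * y)) * f x)"

definition sneddon_conv :: "(real \<Rightarrow> complex) \<Rightarrow> (real \<Rightarrow> complex) \<Rightarrow> real \<Rightarrow> complex" where
  "sneddon_conv f g x =
     of_real (1 / sqrt (2 * pi)) * (LINT u:{0..}|lebesgue. f u * (g \<bar>x - u\<bar> - g (x + u)))"

definition yb_conv :: "(real \<Rightarrow> complex) \<Rightarrow> (real \<Rightarrow> complex) \<Rightarrow> real \<Rightarrow> complex" where
  "yb_conv f g x =
     of_real (1 / 2) * (LINT (u, v):{0..} \<times> {0..}|lebesgue.
       of_real (exp (- u * cosh (v - x)) - exp (- u * cosh (v + x))) * f v * g u)"

definition Phi :: "real \<Rightarrow> real \<Rightarrow> real \<Rightarrow> real \<Rightarrow> real" where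
  "Phi x u v w =
     exp (- w * cosh (x - u + v)) + exp (- w * cosh (x - u - v))
     - exp (- w * cosh (x + u + v)) - exp (- w * cosh (x + u - v))"

definition polyconv ::
  "(real \<Rightarrow> complex) \<Rightarrow> (real \<Rightarrow> complex) \<Rightarrow> (real \<Rightarrow> complex) \<Rightarrow> real \<Rightarrow> complex" where
  "polyconv f g h x =
     of_real (1 / (2 * sqrt (2 * pi))) * (LINT (u, v, w):{0..} \<times> {0..} \<times> {0..}|lebesgue.
       of_real (Phi x u v w) * f u * g v * h w)"

text \<open>The convolutions of integrable functions converge for almost every \<open>x\<close> only, so the integral
  equation is an equation between elements of $L_1$.\<close>

definition L1_solution ::
  "(real \<Rightarrow> complex) \<Rightarrow> (real \<Rightarrow> complex) \<Rightarrow> (real \<Rightarrow> complex) \<Rightarrow> (real \<Rightarrow> complex) \<Rightarrow> bool" where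
  "L1_solution \<xi> \<phi> h f \<longleftrightarrow> f \<in> L1 \<and>
     (AE x in lebesgue. x > 0 \<longrightarrow> f x + sneddon_conv f \<phi> x = polyconv \<xi> \<phi> h x)"

end

theory Submission
  imports Defs "HOL-Probability.Sinc_Integral"
begin

text \<open>
  All objects of the equation become Fourier transforms on the whole line. Extend \<open>\<xi>\<close>, \<open>f\<close> to odd
  functions and \<open>\<phi>\<close>, \<open>l\<close> to even functions. Then Sneddon's convolution is
  \<open>c = 1 / sqrt (2 * pi)\<close> times the ordinary convolution of the odd and the even extension
  (\<open>sneddon_conv_AE\<close>), the cosine transform is \<open>c\<close> times the Fourier transform of the even extension
  (\<open>fourier_cos_eq_FT\<close>), and the polyconvolution and the convolution with the Macdonald weight are
  odd integrable functions whose transforms are the products of the transforms of the extensions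
  with one further factor \<open>M\<close> that depends on \<open>h\<close> only (\<open>FT_polyconv\<close>, \<open>FT_yb_conv\<close>). Writing hats
  for the transforms of the extensions, the equation reads
  \<open>f^ * (1 + c * \<phi>^) = c / 2 * \<xi>^ * \<phi>^ * M\<close>.

  By assumption the factor \<open>1 + c * \<phi>^\<close> has no zero on the line, the transform of an even function
  being even. Injectivity of the Fourier transform on \<open>L1\<close> (\<open>FT_injective\<close>) therefore gives
  uniqueness, and it turns every remaining identity into one between transforms. If \<open>l\<close> has the
  cosine transform \<open>c * l^ = c * \<phi>^ / (1 + c * \<phi>^)\<close>, then the polyconvolution of \<open>\<xi>\<close>, \<open>l\<close>, \<open>h\<close> has the
  transform \<open>c / 2 * \<xi>^ * l^ * M\<close>, which solves the equation, and this is also the transform of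
  the iterated convolution. The norm inequality holds because each of the four terms of the kernel
  has integral \<open>2 * K0 w\<close> over the line in the variable \<open>x\<close>, half of which counts by oddness, and
  because \<open>K0\<close> is decreasing.

  What is deep is the existence of \<open>l\<close> in \<open>L1\<close>: this is Wiener's theorem that
  \<open>FT k / (1 + FT k)\<close> is the transform of an integrable function whenever \<open>k\<close> is integrable and
  \<open>1 + FT k\<close> has no zero (\<open>wiener_inversion\<close>). It is proved by Wiener's localisation. In the norm inherited from \<open>L1\<close>, a
  transform is nearly constant on small intervals and nearly zero far out
  (\<open>FT_local_variation_small\<close>, \<open>FT_tail_small\<close>), so locally the inverse is given by a Neumann series;
  a partition of unity by triangle functions, which are transforms of Fejer kernels, glues the local
  inverses. Both localisation estimates and the injectivity of the transform come from a single
  statement about approximate identities, which rests on the continuity of translation in \<open>L1\<close>.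
\<close>

section \<open>Fourier transform and convolution on the line\<close>

text \<open>
  The unnormalised transform: it turns \<open>conv\<close> into a product with no constant, so that the factors
  \<open>1 / sqrt (2 * pi)\<close> of the half-line theory occur only where that theory is translated.
\<close>

definition FT :: "(real \<Rightarrow> complex) \<Rightarrow> real \<Rightarrow> complex" where
  "FT f y = (\<integral>x. f x * cis (- (x * y)) \<partial>lborel)"

definition conv :: "(real \<Rightarrow> complex) \<Rightarrow> (real \<Rightarrow> complex) \<Rightarrow> real \<Rightarrow> complex" where
  "conv f g x = (\<integral>u. f u * g (x - u) \<partial>lborel)"

lemma integral_shift:
  fixes g :: "real \<Rightarrow> 'b :: {banach, second_countable_topology}"
  shows "(\<integral>x. g (x - a) \<partial>lborel) = (\<integral>x. g x \<partial>lborel)"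
  using lborel_integral_real_affine[of 1 g "-a"] by simp

lemma integrable_shift:
  fixes g :: "real \<Rightarrow> 'b :: {banach, second_countable_topology}"
  assumes "integrable lborel g"
  shows "integrable lborel (\<lambda>x. g (x - a))"
  using lborel_integrable_real_affine[OF assms, of 1 "-a"] by simp

lemma integral_reflect_real:
  fixes g :: "real \<Rightarrow> 'b :: {banach, second_countable_topology}"
  shows "(\<integral>x. g (- x) \<partial>lborel) = (\<integral>x. g x \<partial>lborel)"
  using lborel_integral_real_affine[of "-1" g 0] by simp

lemma integrable_reflect_real:
  fixes g :: "real \<Rightarrow> 'b :: {banach, second_countable_topology}"
  assumes "integrable lborel g"
  shows "integrable lborel (\<lambda>x. g (- x))"
  using lborel_integrable_real_affine[OF assms, of "-1" 0] by simp

lemma measurable_cis [measurable]: "cis \<in> borel_measurable borel"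
  by (intro borel_measurable_continuous_onI continuous_intros)

lemma integrable_mult_unimodular:
  fixes f g :: "'a \<Rightarrow> complex"
  assumes "integrable M f" "g \<in> borel_measurable M" "\<And>x. norm (g x) \<le> 1"
  shows "integrable M (\<lambda>x. f x * g x)"
  using assms(1)
proof (rule Bochner_Integration.integrable_bound)
  show "(\<lambda>x. f x * g x) \<in> borel_measurable M" using assms by measurable
  show "AE x in M. norm (f x * g x) \<le> norm (f x)"
    using assms(3) by (auto simp: norm_mult intro!: mult_left_le)
qed

lemma integrable_FT: "integrable lborel f \<Longrightarrow> integrable lborel (\<lambda>x. f x * cis (- (x * y)))"
  by (rule integrable_mult_unimodular) auto

lemma FT_add: "integrable lborel f \<Longrightarrow> integrable lborel g \<Longrightarrow> FT (\<lambda>x. f x + g x) y = FT f y + FT g y"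
  unfolding FT_def ring_distribs by (intro Bochner_Integration.integral_add integrable_FT)

lemma FT_diff: "integrable lborel f \<Longrightarrow> integrable lborel g \<Longrightarrow> FT (\<lambda>x. f x - g x) y = FT f y - FT g y"
  unfolding FT_def ring_distribs by (intro Bochner_Integration.integral_diff integrable_FT)

lemma FT_cmult: "FT (\<lambda>x. a * f x) y = a * FT f y"
  unfolding FT_def mult.assoc by simp

lemma norm_FT_le: "norm (FT f y) \<le> (\<integral>x. norm (f x) \<partial>lborel)"
  unfolding FT_def using integral_norm_bound[of lborel "\<lambda>x. f x * cis (- (x * y))"]
  by (simp add: norm_mult)

lemma FT_reflect: "FT (\<lambda>x. f (- x)) y = FT f (- y)"
  unfolding FT_def using integral_reflect_real[of "\<lambda>x. f x * cis (x * y)"] by simp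

lemma FT_modulate: "FT (\<lambda>x. f x * cis (x * c)) y = FT f (y - c)"
  unfolding FT_def by (intro Bochner_Integration.integral_cong)
    (auto simp: mult.assoc cis_mult algebra_simps)

lemma FT_dilate: "s > 0 \<Longrightarrow> FT (\<lambda>x. f (x / s) / of_real s) y = FT f (s * y)"
  unfolding FT_def
  by (subst lborel_integral_real_affine[of s _ 0]) (auto simp: scaleR_conv_of_real mult_ac)

lemma FT_cong_AE:
  assumes "f \<in> borel_measurable borel" "g \<in> borel_measurable borel" "AE x in lborel. f x = g x"
  shows "FT f y = FT g y"
  unfolding FT_def
proof (rule integral_cong_AE)
  show "AE x in lborel. f x * cis (- (x * y)) = g x * cis (- (x * y))"
    using assms(3) by eventually_elim simp
qed (use assms in measurable)

lemma continuous_on_FT: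
  assumes "integrable lborel f"
  shows "continuous_on UNIV (FT f)"
proof (rule continuous_at_imp_continuous_on, rule ballI)
  fix y :: real
  have m [measurable]: "f \<in> borel_measurable borel" using assms by auto
  show "isCont (FT f) y"
    unfolding continuous_at_sequentially
  proof (intro allI impI)
    fix z :: "nat \<Rightarrow> real" assume z: "z \<longlonglongrightarrow> y"
    show "(FT f \<circ> z) \<longlonglongrightarrow> FT f y"
      unfolding FT_def comp_def
    proof (rule integral_dominated_convergence)
      show "integrable lborel (\<lambda>x. norm (f x))" using assms by simp
      show "AE x in lborel. (\<lambda>i. f x * cis (- (x * z i))) \<longlonglongrightarrow> f x * cis (- (x * y))"
        by (intro AE_I2 tendsto_intros tendsto_cis z)
      show "AE x in lborel. norm (f x * cis (- (x * z i))) \<le> norm (f x)" for i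
        by (simp add: norm_mult)
    qed auto
  qed
qed

text \<open>
  The function \<open>(u, x) \<mapsto> f u * g (x - u)\<close> is integrable on the plane because, for fixed \<open>u\<close>, its
  integral over \<open>x\<close> is translation invariant. Integrability of the convolution, its norm bound and
  its Fourier transform are then all instances of Fubini's theorem.
\<close>

lemma integrable_shear:
  fixes f g :: "real \<Rightarrow> complex"
  assumes f: "integrable lborel f" and g: "integrable lborel g"
  shows "integrable (lborel \<Otimes>\<^sub>M lborel) (\<lambda>(u, x). f u * g (x - u))"
proof (rule lborel_pair.Fubini_integrable)
  have [measurable]: "f \<in> borel_measurable borel" "g \<in> borel_measurable borel"
    using f g by auto
  show "(\<lambda>(u, x). f u * g (x - u)) \<in> borel_measurable (lborel \<Otimes>\<^sub>M lborel)"
    by measurable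
  show "integrable lborel (\<lambda>u. \<integral>x. norm (case (u, x) of (u, x) \<Rightarrow> f u * g (x - u)) \<partial>lborel)"
    using f by (simp add: norm_mult integral_shift[of "\<lambda>x. norm (g x)"])
  show "AE u in lborel. integrable lborel (\<lambda>x. case (u, x) of (u, x) \<Rightarrow> f u * g (x - u))"
    using g by (simp add: integrable_shift)
qed

text \<open>
  Minkowski's inequality for integrals in the case of the \<open>L1\<close> norm: the norm of a superposition is at
  most the superposition of the norms.
\<close>

lemma integral_norm_integral_le:
  fixes F :: "'a \<Rightarrow> real \<Rightarrow> complex"
  assumes "sigma_finite_measure M" and F: "integrable (M \<Otimes>\<^sub>M lborel) (case_prod F)"
  shows "(\<integral>x. norm (\<integral>u. F u x \<partial>M) \<partial>lborel) \<le> (\<integral>u. (\<integral>x. norm (F u x) \<partial>lborel) \<partial>M)"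
proof -
  interpret M: sigma_finite_measure M by fact
  interpret P: pair_sigma_finite M lborel ..
  have N: "integrable (M \<Otimes>\<^sub>M lborel) (\<lambda>(u, x). norm (F u x))"
    using integrable_norm[OF F] by (simp add: case_prod_unfold)
  have "(\<integral>x. norm (\<integral>u. F u x \<partial>M) \<partial>lborel) \<le> (\<integral>x. (\<integral>u. norm (F u x) \<partial>M) \<partial>lborel)"
    using P.integrable_snd[OF F] P.integrable_snd[OF N] by (intro integral_mono) auto
  also have "\<dots> = (\<integral>u. (\<integral>x. norm (F u x) \<partial>lborel) \<partial>M)"
    using P.Fubini_integral[OF N] .
  finally show ?thesis .
qed

lemma integrable_conv:
  assumes "integrable lborel f" "integrable lborel g"
  shows "integrable lborel (conv f g)"
  using lborel_pair.integrable_snd[OF integrable_shear[OF assms]] unfolding conv_def [abs_def] .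

lemma AE_integrable_conv:
  fixes f g :: "real \<Rightarrow> complex"
  assumes "integrable lborel f" "integrable lborel g"
  shows "AE x in lborel. integrable lborel (\<lambda>u. f u * g (x - u))"
  using lborel_pair.AE_integrable_snd[OF integrable_shear[OF assms]] .

lemma conv_norm_le:
  assumes f: "integrable lborel f" and g: "integrable lborel g"
  shows "(\<integral>x. norm (conv f g x) \<partial>lborel) \<le> (\<integral>x. norm (f x) \<partial>lborel) * (\<integral>x. norm (g x) \<partial>lborel)"
  using integral_norm_integral_le[OF lborel.sigma_finite_measure_axioms integrable_shear[OF f g]]
  by (simp add: conv_def norm_mult integral_shift[of "\<lambda>x. norm (g x)"])

lemma FT_conv:
  assumes f: "integrable lborel f" and g: "integrable lborel g"
  shows "FT (conv f g) y = FT f y * FT g y"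
proof -
  have I: "integrable (lborel \<Otimes>\<^sub>M lborel) (\<lambda>(u, x). f u * g (x - u) * cis (- (x * y)))"
    using integrable_mult_unimodular[OF integrable_shear[OF f g], of "\<lambda>(u, x). cis (- (x * y))"]
    by (simp add: case_prod_unfold)
  have "FT (conv f g) y = (\<integral>x. (\<integral>u. f u * g (x - u) * cis (- (x * y)) \<partial>lborel) \<partial>lborel)"
    unfolding FT_def conv_def by simp
  also have "\<dots> = (\<integral>u. (\<integral>x. f u * g (x - u) * cis (- (x * y)) \<partial>lborel) \<partial>lborel)"
    by (rule lborel_pair.Fubini_integral[OF I])
  also have "\<dots> = (\<integral>u. f u * cis (- (u * y)) * FT g y \<partial>lborel)"
  proof (intro Bochner_Integration.integral_cong refl)
    fix u :: real
    have "(\<integral>x. f u * g (x - u) * cis (- (x * y)) \<partial>lborel) =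
          (\<integral>x. f u * cis (- (u * y)) * (g (x - u) * cis (- ((x - u) * y))) \<partial>lborel)"
    proof (intro Bochner_Integration.integral_cong refl)
      fix x :: real
      have "cis (- (x * y)) = cis (- (u * y)) * cis (- ((x - u) * y))"
        by (simp add: cis_mult algebra_simps)
      then show "f u * g (x - u) * cis (- (x * y)) =
          f u * cis (- (u * y)) * (g (x - u) * cis (- ((x - u) * y)))" by simp
    qed
    also have "\<dots> = f u * cis (- (u * y)) * FT g y"
      by (simp add: FT_def integral_shift[of "\<lambda>x. g x * cis (- (x * y))"])
    finally show "(\<integral>x. f u * g (x - u) * cis (- (x * y)) \<partial>lborel) = f u * cis (- (u * y)) * FT g y" .
  qed
  also have "\<dots> = FT f y * FT g y"
    by (simp add: FT_def)
  finally show ?thesis .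
qed

section \<open>Continuity of translation and approximate identities\<close>

definition L1_modulus :: "(real \<Rightarrow> complex) \<Rightarrow> real \<Rightarrow> real" where
  "L1_modulus b t = (\<integral>x. norm (b (x - t) - b x) \<partial>lborel)"

lemma L1_modulus_0 [simp]: "L1_modulus b 0 = 0"
  by (simp add: L1_modulus_def)

lemma L1_modulus_nonneg: "0 \<le> L1_modulus b t"
  by (simp add: L1_modulus_def)

text \<open>
  The modulus is Lipschitz in the \<open>L1\<close> norm, uniformly in the translation. This makes continuity at
  \<open>0\<close> pass to \<open>L1\<close> limits, which reduces it to indicator functions.
\<close>

lemma L1_modulus_le:
  assumes f: "integrable lborel f" and g: "integrable lborel g"
  shows "L1_modulus f t \<le> L1_modulus g t + 2 * (\<integral>x. norm (f x - g x) \<partial>lborel)"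
proof -
  have fg: "integrable lborel (\<lambda>x. norm (f x - g x))" using f g by auto
  have "L1_modulus f t \<le> (\<integral>x. norm (g (x - t) - g x) + norm (f (x - t) - g (x - t)) + norm (f x - g x) \<partial>lborel)"
    unfolding L1_modulus_def
  proof (rule integral_mono)
    fix x show "norm (f (x - t) - f x) \<le> norm (g (x - t) - g x) + norm (f (x - t) - g (x - t)) + norm (f x - g x)"
      by norm
  qed (use f g integrable_shift[OF f, of t] integrable_shift[OF g, of t] in auto)
  also have "\<dots> = L1_modulus g t + (\<integral>x. norm (f (x - t) - g (x - t)) \<partial>lborel) + (\<integral>x. norm (f x - g x) \<partial>lborel)"
    unfolding L1_modulus_def
    using f g fg by (simp add: integrable_shift)
  also have "(\<integral>x. norm (f (x - t) - g (x - t)) \<partial>lborel) = (\<integral>x. norm (f x - g x) \<partial>lborel)"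
    by (rule integral_shift[of "\<lambda>x. norm (f x - g x)"])
  finally show ?thesis by simp
qed

lemma L1_modulus_bounded:
  assumes f: "integrable lborel f"
  shows "L1_modulus f t \<le> 2 * (\<integral>x. norm (f x) \<partial>lborel)"
  using L1_modulus_le[OF f, of "\<lambda>x. 0" t] by (simp add: L1_modulus_def)

lemma L1_modulus_tendsto_approx:
  assumes f: "integrable lborel f"
    and approx: "\<And>e. e > 0 \<Longrightarrow> \<exists>g. integrable lborel g \<and> isCont (L1_modulus g) 0 \<and> (\<integral>x. norm (f x - g x) \<partial>lborel) < e"
  shows "isCont (L1_modulus f) 0"
  unfolding continuous_at_eps_delta
proof (intro allI impI)
  fix e :: real assume "e > 0"
  then obtain g where g: "integrable lborel g" "isCont (L1_modulus g) 0"
      and *: "(\<integral>x. norm (f x - g x) \<partial>lborel) < e / 4"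
    using approx[of "e/4"] by auto
  obtain d where d: "d > 0" "\<And>t. \<bar>t\<bar> < d \<Longrightarrow> \<bar>L1_modulus g t\<bar> < e / 2"
    using g(2) \<open>e > 0\<close> unfolding continuous_at_eps_delta dist_real_def
    by (metis L1_modulus_0 diff_zero half_gt_zero)
  show "\<exists>d>0. \<forall>t. dist t 0 < d \<longrightarrow> dist (L1_modulus f t) (L1_modulus f 0) < e"
  proof (intro exI conjI allI impI)
    fix t :: real assume "dist t 0 < d"
    then have "L1_modulus g t < e / 2" using d(2)[of t] by auto
    with L1_modulus_le[OF f g(1), of t] * show "dist (L1_modulus f t) (L1_modulus f 0) < e"
      using L1_modulus_nonneg[of f t] by (simp add: dist_real_def)
  qed fact
qed

lemma integrable_indicator_complex:
  assumes "A \<in> sets M" "emeasure M A < \<infinity>"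
  shows "integrable M (\<lambda>x. indicator A x :: complex)"
proof -
  have "integrable M (\<lambda>x. of_real (indicator A x :: real) :: complex)"
    using assms by (intro integrable_of_real integrable_real_indicator)
  moreover have "(\<lambda>x. of_real (indicator A x :: real) :: complex) = indicator A"
    by (auto split: split_indicator)
  ultimately show ?thesis by simp
qed

text \<open>
  Since an indicator and its translate have the same integral, the \<open>L1\<close> distance between them is
  twice the integral of the positive part of their difference. That part is dominated by the
  indicator of \<open>U\<close>, and it tends to \<open>0\<close> pointwise because a point of the open set \<open>U\<close> stays in \<open>U\<close>
  under small translations. For a general Borel set pointwise convergence may fail; it is approximated from
  outside by open sets.
\<close>

lemma L1_modulus_indicator_open:
  assumes U: "open U" "emeasure lborel U < \<infinity>"
  shows "isCont (L1_modulus (\<lambda>x. indicator U x)) 0"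
  unfolding continuous_at_sequentially
proof (intro allI impI)
  fix z :: "nat \<Rightarrow> real" assume z: "z \<longlonglongrightarrow> 0"
  have [measurable]: "U \<in> sets borel" using U by simp
  let ?i = "indicator U :: real \<Rightarrow> real"
  have I: "integrable lborel ?i" using U by (intro integrable_real_indicator) auto
  note I' = integrable_shift[OF I]
  have eq: "L1_modulus (\<lambda>x. indicator U x) t = 2 * (\<integral>x. max 0 (?i x - ?i (x - t)) \<partial>lborel)" for t
  proof -
    have "L1_modulus (\<lambda>x. indicator U x) t = (\<integral>x. (?i (x - t) - ?i x) + 2 * max 0 (?i x - ?i (x - t)) \<partial>lborel)"
      unfolding L1_modulus_def
      by (intro Bochner_Integration.integral_cong) (auto split: split_indicator)
    also have "\<dots> = 2 * (\<integral>x. max 0 (?i x - ?i (x - t)) \<partial>lborel)"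
      using I I' by (simp add: integral_shift[of ?i])
    finally show ?thesis .
  qed
  have "(\<lambda>n. \<integral>x. max 0 (?i x - ?i (x - z n)) \<partial>lborel) \<longlonglongrightarrow> (\<integral>x. 0 \<partial>(lborel :: real measure))"
  proof (rule integral_dominated_convergence)
    show "integrable lborel ?i" by fact
    show "AE x in lborel. (\<lambda>n. max 0 (?i x - ?i (x - z n))) \<longlonglongrightarrow> 0"
    proof (rule AE_I2)
      fix x :: real
      have *: "(\<lambda>n. x - z n) \<longlonglongrightarrow> x" using tendsto_diff[OF tendsto_const[of x] z] by simp
      show "(\<lambda>n. max 0 (?i x - ?i (x - z n))) \<longlonglongrightarrow> 0"
      proof (cases "x \<in> U")
        case True
        then have "\<forall>\<^sub>F n in sequentially. x - z n \<in> U"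
          using topological_tendstoD[OF * U(1)] by simp
        then have "\<forall>\<^sub>F n in sequentially. max 0 (?i x - ?i (x - z n)) = 0"
          by eventually_elim (auto split: split_indicator)
        then show ?thesis by (rule tendsto_eventually)
      qed (auto split: split_indicator)
    qed
    show "AE x in lborel. norm (max 0 (?i x - ?i (x - z n))) \<le> ?i x" for n
      by (auto split: split_indicator)
  qed auto
  then show "(L1_modulus (\<lambda>x. indicator U x) \<circ> z) \<longlonglongrightarrow> L1_modulus (\<lambda>x. indicator U x) 0"
    by (simp add: eq comp_def tendsto_mult_right_zero)
qed

lemma L1_modulus_indicator:
  assumes A [measurable]: "A \<in> sets lborel" "emeasure lborel A < \<infinity>"
  shows "isCont (L1_modulus (\<lambda>x. indicator A x)) 0"
proof (rule L1_modulus_tendsto_approx)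
  show "integrable lborel (\<lambda>x. indicator A x :: complex)"
    using assms by (rule integrable_indicator_complex)
  fix e :: real assume e: "e > 0"
  obtain U where U: "open U" "A \<subseteq> U" "emeasure lborel (U - A) < e"
    using outer_regular_lborel[OF _ e] A by (metis sets_lborel)
  have [measurable]: "U \<in> sets borel" using U by simp
  have "emeasure lborel U \<le> emeasure lborel A + emeasure lborel (U - A)"
    using U A by (subst plus_emeasure) (auto intro!: emeasure_mono)
  also have "\<dots> < \<infinity>" using A(2) U(3)
    by (simp add: less_top[symmetric]) (metis ennreal_neq_top top.extremum_strict)
  finally have fin: "emeasure lborel U < \<infinity>" .
  have "(\<integral>x. norm (indicator A x - indicator U x :: complex) \<partial>lborel) = (\<integral>x. indicator (U - A) x \<partial>lborel)"
    using U(2) by (intro Bochner_Integration.integral_cong) (auto split: split_indicator)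
  also have "\<dots> = measure lborel (U - A)" by simp
  also have "\<dots> < e"
    using U(3) e by (metis emeasure_eq_ennreal_measure ennreal_less_iff measure_nonneg top.extremum_strict)
  finally show "\<exists>g. integrable lborel g \<and> isCont (L1_modulus g) 0 \<and> (\<integral>x. norm (indicator A x - g x :: complex) \<partial>lborel) < e"
    using fin U L1_modulus_indicator_open[OF U(1) fin]
    by (intro exI[of _ "\<lambda>x. indicator U x"]) (auto intro!: integrable_indicator_complex)
qed

lemma L1_modulus_add:
  assumes f: "integrable lborel f" and g: "integrable lborel g"
  shows "L1_modulus (\<lambda>x. f x + g x) t \<le> L1_modulus f t + L1_modulus g t"
proof -
  have "L1_modulus (\<lambda>x. f x + g x) t \<le> (\<integral>x. norm (f (x - t) - f x) + norm (g (x - t) - g x) \<partial>lborel)"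
    unfolding L1_modulus_def
  proof (rule integral_mono)
    fix x show "norm (f (x - t) + g (x - t) - (f x + g x)) \<le> norm (f (x - t) - f x) + norm (g (x - t) - g x)"
      by norm
  qed (use f g integrable_shift[OF f, of t] integrable_shift[OF g, of t] in auto)
  then show ?thesis
    using f g by (simp add: L1_modulus_def integrable_shift)
qed

lemma isCont_L1_modulus:
  assumes "integrable lborel f"
  shows "isCont (L1_modulus f) 0"
  using assms
proof (induction f rule: integrable_induct)
  case (base A c)
  have "L1_modulus (\<lambda>x. indicator A x *\<^sub>R c) t = norm c * L1_modulus (\<lambda>x. indicator A x) t" for t
    unfolding L1_modulus_def
    by (subst integral_mult_right_zero[symmetric], intro Bochner_Integration.integral_cong)
       (auto split: split_indicator)
  then have "L1_modulus (\<lambda>x. indicator A x *\<^sub>R c) = (\<lambda>t. norm c * L1_modulus (\<lambda>x. indicator A x) t)"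
    by (rule ext)
  with L1_modulus_indicator[OF base] show ?case by (auto intro!: continuous_intros)
next
  case (add f g)
  show ?case
    unfolding isCont_def
  proof (rule tendsto_sandwich)
    show "\<forall>\<^sub>F t in at 0. L1_modulus (\<lambda>x. f x + g x) 0 \<le> L1_modulus (\<lambda>x. f x + g x) t"
      by (simp add: L1_modulus_nonneg)
    show "\<forall>\<^sub>F t in at 0. L1_modulus (\<lambda>x. f x + g x) t \<le> L1_modulus f t + L1_modulus g t"
      using L1_modulus_add[OF add(1,2)] by simp
    show "(\<lambda>t. L1_modulus f t + L1_modulus g t) \<midarrow>0\<rightarrow> L1_modulus (\<lambda>x. f x + g x) 0"
      using tendsto_add[OF add(3,4)[unfolded isCont_def]] by simp
  qed simp
next
  case (lim f s)
  show ?case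
  proof (rule L1_modulus_tendsto_approx)
    fix e :: real assume "e > 0"
    have [measurable]: "f \<in> borel_measurable borel" "\<And>i. s i \<in> borel_measurable borel"
      using lim by auto
    have "(\<lambda>i. \<integral>x. norm (f x - s i x) \<partial>lborel) \<longlonglongrightarrow> (\<integral>x. 0 \<partial>(lborel :: real measure))"
    proof (rule integral_dominated_convergence)
      show "integrable lborel (\<lambda>x. 3 * norm (f x))" using lim by auto
      show "AE x in lborel. (\<lambda>i. norm (f x - s i x)) \<longlonglongrightarrow> 0"
      proof (rule AE_I2)
        fix x
        have "(\<lambda>i. f x - s i x) \<longlonglongrightarrow> f x - f x" using lim by (intro tendsto_intros) auto
        then show "(\<lambda>i. norm (f x - s i x)) \<longlonglongrightarrow> 0" by (simp add: tendsto_norm_zero)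
      qed
      show "AE x in lborel. norm (norm (f x - s i x)) \<le> 3 * norm (f x)" for i
      proof (rule AE_I2)
        fix x
        have "norm (f x - s i x) \<le> norm (f x) + norm (s i x)" by (rule norm_triangle_ineq4)
        moreover have "norm (s i x) \<le> 2 * norm (f x)" using lim by simp
        ultimately show "norm (norm (f x - s i x)) \<le> 3 * norm (f x)" by simp
      qed
    qed auto
    then have "\<forall>\<^sub>F i in sequentially. (\<integral>x. norm (f x - s i x) \<partial>lborel) < e"
      using order_tendstoD(2)[of _ 0 sequentially e] \<open>e > 0\<close> by simp
    then obtain i where "(\<integral>x. norm (f x - s i x) \<partial>lborel) < e"
      by (auto simp: eventually_sequentially)
    with lim show "\<exists>g. integrable lborel g \<and> isCont (L1_modulus g) 0 \<and> (\<integral>x. norm (f x - g x) \<partial>lborel) < e"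
      by blast
  qed fact
qed

lemma L1_modulus_measurable [measurable]:
  assumes [measurable]: "b \<in> borel_measurable borel"
  shows "L1_modulus b \<in> borel_measurable borel"
  unfolding L1_modulus_def [abs_def] by measurable

text \<open>
  \<open>FT a 0\<close> is the integral of \<open>a\<close>, so the difference equals \<open>\<integral>u. a u * (b (x - u) - b x)\<close>, to which
  Minkowski's inequality applies.
\<close>

lemma conv_minus_multiple_norm_le:
  assumes a: "integrable lborel a" and b: "integrable lborel b"
  shows "(\<integral>x. norm (conv a b x - FT a 0 * b x) \<partial>lborel) \<le> (\<integral>u. norm (a u) * L1_modulus b u \<partial>lborel)"
proof -
  have P: "integrable (lborel \<Otimes>\<^sub>M lborel) (\<lambda>(u, x). a u * b x)"
  proof (rule lborel_pair.Fubini_integrable)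
    have [measurable]: "a \<in> borel_measurable borel" "b \<in> borel_measurable borel" using a b by auto
    show "(\<lambda>(u, x). a u * b x) \<in> borel_measurable (lborel \<Otimes>\<^sub>M lborel)" by measurable
  qed (use a b in \<open>auto simp: norm_mult\<close>)
  have I: "integrable (lborel \<Otimes>\<^sub>M lborel) (\<lambda>(u, x). a u * (b (x - u) - b x))"
    using Bochner_Integration.integrable_diff[OF integrable_shear[OF a b] P]
    by (simp add: case_prod_unfold ring_distribs)
  have [measurable]: "a \<in> borel_measurable borel" "b \<in> borel_measurable borel"
      "conv a b \<in> borel_measurable borel"
    using a b integrable_conv[OF a b] by auto
  have "(\<integral>x. norm (conv a b x - FT a 0 * b x) \<partial>lborel) = (\<integral>x. norm (\<integral>u. a u * (b (x - u) - b x) \<partial>lborel) \<partial>lborel)"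
  proof (rule integral_cong_AE)
    show "AE x in lborel. norm (conv a b x - FT a 0 * b x) = norm (\<integral>u. a u * (b (x - u) - b x) \<partial>lborel)"
      using AE_integrable_conv[OF a b]
    proof eventually_elim
      case (elim x)
      then show ?case using a by (simp add: conv_def FT_def ring_distribs)
    qed
  qed measurable
  also have "\<dots> \<le> (\<integral>u. (\<integral>x. norm (a u * (b (x - u) - b x)) \<partial>lborel) \<partial>lborel)"
    by (rule integral_norm_integral_le[OF lborel.sigma_finite_measure_axioms I])
  also have "\<dots> = (\<integral>u. norm (a u) * L1_modulus b u \<partial>lborel)"
    by (simp add: norm_mult L1_modulus_def)
  finally show ?thesis .
qed

lemma integrable_dilate:
  fixes a :: "real \<Rightarrow> complex"
  shows "integrable lborel a \<Longrightarrow> s > 0 \<Longrightarrow> integrable lborel (\<lambda>x. a (x / s) / of_real s)"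
  using lborel_integrable_real_affine[of a "1/s" 0] by simp

text \<open>
  After the substitution \<open>u = s * t\<close> the bound for the dilated kernel is the integral of
  \<open>norm (a t) * L1_modulus b (s * t)\<close>, which tends to \<open>0\<close> with \<open>s\<close> by dominated convergence. As it
  depends on the modulus of the kernel only, the same \<open>s\<close> serves every modulation \<open>a'\<close> of \<open>a\<close>; a
  modulation shifts the Fourier transform, so this gives estimates that are uniform in the frequency
  around which one localises. The lemma is used in two ways: with \<open>b\<close> as the given function and \<open>a\<close>
  as a fixed kernel, and with these roles exchanged.
\<close>

lemma approximate_identity:
  fixes a b :: "real \<Rightarrow> complex"
  assumes a: "integrable lborel a" and b: "integrable lborel b" and e: "e > 0"
  shows "\<exists>s>0. \<forall>a'. integrable lborel a' \<longrightarrow> (\<forall>x. norm (a' x) = norm (a x)) \<longrightarrow>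
    (\<integral>x. norm (conv (\<lambda>x. a' (x / s) / of_real s) b x - FT a' 0 * b x) \<partial>lborel) \<le> e"
proof -
  have [measurable]: "a \<in> borel_measurable borel" "b \<in> borel_measurable borel" using a b by auto
  define X :: "nat \<Rightarrow> real" where "X n = 1 / (real n + 1)" for n
  have X: "X \<longlonglongrightarrow> 0" "\<And>n. X n > 0"
    unfolding X_def using LIMSEQ_inverse_real_of_nat by (auto simp: inverse_eq_divide add.commute)
  have "(\<lambda>n. \<integral>t. norm (a t) * L1_modulus b (X n * t) \<partial>lborel) \<longlonglongrightarrow> (\<integral>t. 0 \<partial>(lborel :: real measure))"
  proof (rule integral_dominated_convergence)
    show "integrable lborel (\<lambda>t. norm (a t) * (2 * (\<integral>x. norm (b x) \<partial>lborel)))" using a by auto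
    show "AE t in lborel. norm (norm (a t) * L1_modulus b (X n * t)) \<le> norm (a t) * (2 * (\<integral>x. norm (b x) \<partial>lborel))" for n
      using L1_modulus_bounded[OF b] by (auto simp: L1_modulus_nonneg abs_mult intro!: mult_left_mono)
    show "AE t in lborel. (\<lambda>n. norm (a t) * L1_modulus b (X n * t)) \<longlonglongrightarrow> 0"
    proof (rule AE_I2)
      fix t :: real
      have "(\<lambda>n. X n * t) \<longlonglongrightarrow> 0" using tendsto_mult_left_zero[OF X(1)] .
      then have "(\<lambda>n. L1_modulus b (X n * t)) \<longlonglongrightarrow> L1_modulus b 0"
        using isCont_tendsto_compose[OF isCont_L1_modulus[OF b]] by blast
      then show "(\<lambda>n. norm (a t) * L1_modulus b (X n * t)) \<longlonglongrightarrow> 0"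
        by (simp add: tendsto_mult_right_zero)
    qed
  qed auto
  then have "\<forall>\<^sub>F n in sequentially. (\<integral>t. norm (a t) * L1_modulus b (X n * t) \<partial>lborel) < e"
    using order_tendstoD(2)[of _ 0 sequentially e] e by simp
  then obtain n where n: "(\<integral>t. norm (a t) * L1_modulus b (X n * t) \<partial>lborel) < e"
    by (auto simp: eventually_sequentially)
  define s where "s = X n"
  have s: "s > 0" using X by (simp add: s_def)
  show ?thesis
  proof (intro exI conjI allI impI)
    fix a' :: "real \<Rightarrow> complex" assume a': "integrable lborel a'" "\<forall>x. norm (a' x) = norm (a x)"
    let ?a = "\<lambda>x. a' (x / s) / of_real s"
    have "FT ?a 0 = FT a' 0" using FT_dilate[OF s, of a' 0] by simp
    then have "(\<integral>x. norm (conv ?a b x - FT a' 0 * b x) \<partial>lborel) \<le> (\<integral>u. norm (?a u) * L1_modulus b u \<partial>lborel)"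
      using conv_minus_multiple_norm_le[OF integrable_dilate[OF a'(1) s] b] by simp
    also have "\<dots> = (\<integral>t. norm (a t) * L1_modulus b (s * t) \<partial>lborel)"
      using s a'(2) by (subst lborel_integral_real_affine[of s _ 0]) (auto simp: norm_divide)
    finally show "(\<integral>x. norm (conv ?a b x - FT a' 0 * b x) \<partial>lborel) \<le> e"
      using n by (simp add: s_def)
  qed fact
qed

section \<open>The algebra of Fourier transforms\<close>

text \<open>
  The algebra \<open>A\<close> of Fourier transforms of integrable functions carries the \<open>L1\<close> norm of the preimage.
  The predicate says that \<open>g\<close> belongs to \<open>A\<close> with norm at most \<open>r\<close>, so that estimates in \<open>L1\<close> can be
  carried along pointwise identities between transforms.
\<close>

definition fourier_norm_le :: "(real \<Rightarrow> complex) \<Rightarrow> real \<Rightarrow> bool" where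
  "fourier_norm_le g r \<longleftrightarrow>
     (\<exists>f. integrable lborel f \<and> (\<integral>x. norm (f x) \<partial>lborel) \<le> r \<and> (\<forall>y. FT f y = g y))"

lemma fourier_norm_leI:
  "integrable lborel f \<Longrightarrow> (\<integral>x. norm (f x) \<partial>lborel) \<le> r \<Longrightarrow> (\<And>y. FT f y = g y) \<Longrightarrow> fourier_norm_le g r"
  by (auto simp: fourier_norm_le_def)

lemma fourier_norm_le_bound: "fourier_norm_le g r \<Longrightarrow> norm (g y) \<le> r"
  unfolding fourier_norm_le_def using norm_FT_le order_trans by metis

lemma fourier_norm_le_nonneg: "fourier_norm_le g r \<Longrightarrow> 0 \<le> r"
  using fourier_norm_le_bound[of g r 0] by (metis norm_ge_zero order_trans)

lemma fourier_norm_le_mult: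
  assumes "fourier_norm_le g r" "fourier_norm_le h q"
  shows "fourier_norm_le (\<lambda>y. g y * h y) (r * q)"
proof -
  obtain a where a: "integrable lborel a" "(\<integral>x. norm (a x) \<partial>lborel) \<le> r" "\<And>y. FT a y = g y"
    using assms by (auto simp: fourier_norm_le_def)
  obtain b where b: "integrable lborel b" "(\<integral>x. norm (b x) \<partial>lborel) \<le> q" "\<And>y. FT b y = h y"
    using assms by (auto simp: fourier_norm_le_def)
  show ?thesis
  proof (rule fourier_norm_leI)
    show "integrable lborel (conv a b)" by (rule integrable_conv[OF a(1) b(1)])
    have "(\<integral>x. norm (conv a b x) \<partial>lborel) \<le> (\<integral>x. norm (a x) \<partial>lborel) * (\<integral>x. norm (b x) \<partial>lborel)"
      by (rule conv_norm_le[OF a(1) b(1)])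
    also have "\<dots> \<le> r * q"
      using a(2) b(2) fourier_norm_le_nonneg[OF assms(1)] by (intro mult_mono) auto
    finally show "(\<integral>x. norm (conv a b x) \<partial>lborel) \<le> r * q" .
    show "FT (conv a b) y = g y * h y" for y
      by (simp add: FT_conv a b)
  qed
qed

lemma fourier_norm_le_cmult:
  assumes "fourier_norm_le g r"
  shows "fourier_norm_le (\<lambda>y. c * g y) (norm c * r)"
proof -
  obtain a where a: "integrable lborel a" "(\<integral>x. norm (a x) \<partial>lborel) \<le> r" "\<And>y. FT a y = g y"
    using assms by (auto simp: fourier_norm_le_def)
  then show ?thesis
    by (intro fourier_norm_leI[of "\<lambda>x. c * a x"]) (auto simp: norm_mult FT_cmult intro!: mult_left_mono)
qed

lemma fourier_norm_le_add:
  assumes "fourier_norm_le g r" "fourier_norm_le h q"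
  shows "fourier_norm_le (\<lambda>y. g y + h y) (r + q)"
proof -
  obtain a where a: "integrable lborel a" "(\<integral>x. norm (a x) \<partial>lborel) \<le> r" "\<And>y. FT a y = g y"
    using assms by (auto simp: fourier_norm_le_def)
  obtain b where b: "integrable lborel b" "(\<integral>x. norm (b x) \<partial>lborel) \<le> q" "\<And>y. FT b y = h y"
    using assms by (auto simp: fourier_norm_le_def)
  have "(\<integral>x. norm (a x + b x) \<partial>lborel) \<le> (\<integral>x. norm (a x) + norm (b x) \<partial>lborel)"
    using a b by (intro integral_mono) (auto intro: norm_triangle_ineq)
  also have "\<dots> \<le> r + q" using a b by auto
  finally show ?thesis
    using a b by (intro fourier_norm_leI[of "\<lambda>x. a x + b x"]) (auto simp: FT_add)
qed

lemma fourier_norm_le_affine: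
  assumes "fourier_norm_le g r" "s > 0"
  shows "fourier_norm_le (\<lambda>y. g (s * y + c)) r"
proof -
  obtain a where a: "integrable lborel a" "(\<integral>x. norm (a x) \<partial>lborel) \<le> r" "\<And>y. FT a y = g y"
    using assms by (auto simp: fourier_norm_le_def)
  let ?m = "\<lambda>x. a x * cis (x * (- c))"
  show ?thesis
  proof (rule fourier_norm_leI)
    show "integrable lborel (\<lambda>x. ?m (x / s) / of_real s)"
      using assms(2) a(1) by (intro integrable_dilate integrable_mult_unimodular) auto
    have "(\<integral>x. norm (?m (x / s) / of_real s) \<partial>lborel) = (\<integral>x. norm (a x) \<partial>lborel)"
      using assms(2) by (subst lborel_integral_real_affine[of s _ 0]) (auto simp: norm_divide norm_mult)
    with a(2) show "(\<integral>x. norm (?m (x / s) / of_real s) \<partial>lborel) \<le> r" by simp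
    show "FT (\<lambda>x. ?m (x / s) / of_real s) y = g (s * y + c)" for y
      by (subst FT_dilate[OF assms(2)], subst FT_modulate) (simp add: a)
  qed
qed

text \<open>
  The geometric series \<open>\<Sum>n. g y ^ Suc n\<close> converges in the norm of \<open>A\<close>, because the norm is
  submultiplicative. Summability of the norms of the preimages \<open>f n\<close> yields their almost everywhere
  absolutely convergent sum, which may be integrated term by term.
\<close>

lemma fourier_norm_le_neumann:
  assumes g: "fourier_norm_le g q" and q: "q < 1"
  shows "\<exists>r. fourier_norm_le (\<lambda>y. g y / (1 - g y)) r"
proof -
  have q0: "0 \<le> q" by (rule fourier_norm_le_nonneg[OF g])
  have "fourier_norm_le (\<lambda>y. g y ^ Suc n) (q ^ Suc n)" for n
  proof (induction n)
    case (Suc n)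
    from fourier_norm_le_mult[OF g this] show ?case by simp
  qed (use g in simp)
  then have "\<forall>n. \<exists>f. integrable lborel f \<and> (\<integral>x. norm (f x) \<partial>lborel) \<le> q ^ Suc n \<and> (\<forall>y. FT f y = g y ^ Suc n)"
    by (simp add: fourier_norm_le_def)
  then obtain f where f: "\<And>n. integrable lborel (f n)" "\<And>n. (\<integral>x. norm (f n x) \<partial>lborel) \<le> q ^ Suc n"
      "\<And>n y. FT (f n) y = g y ^ Suc n"
    by metis
  have [measurable]: "f n \<in> borel_measurable borel" for n using f(1)[of n] by auto
  have sq: "summable (\<lambda>n. q ^ Suc n)" using q q0 by (simp add: summable_mult)
  have sum: "summable (\<lambda>n. \<integral>x. norm (f n x) \<partial>lborel)"
    by (rule summable_comparison_test'[OF sq, of 0]) (simp del: power_Suc add: f(2))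
  have "(\<integral>\<^sup>+x. (\<Sum>n. ennreal (norm (f n x))) \<partial>lborel) = (\<Sum>n. \<integral>\<^sup>+x. ennreal (norm (f n x)) \<partial>lborel)"
    by (rule nn_integral_suminf) auto
  also have "\<dots> = (\<Sum>n. ennreal (\<integral>x. norm (f n x) \<partial>lborel))"
    using f(1) by (simp add: nn_integral_eq_integral)
  also have "\<dots> \<noteq> \<infinity>" using sum by (simp add: ennreal_suminf_neq_top)
  finally have "AE x in lborel. (\<Sum>n. ennreal (norm (f n x))) \<noteq> \<infinity>"
    by (intro nn_integral_PInf_AE) auto
  then have AEs: "AE x in lborel. summable (\<lambda>n. norm (f n x))"
    by eventually_elim (simp add: summable_suminf_not_top)
  define F where "F x = (\<Sum>n. f n x)" for x
  have FT: "FT F y = g y / (1 - g y)" for y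
  proof -
    let ?h = "\<lambda>n x. f n x * cis (- (x * y))"
    have h: "integrable lborel (?h n)" for n by (rule integrable_FT[OF f(1)])
    have hs: "AE x in lborel. summable (\<lambda>n. norm (?h n x))" using AEs by (simp add: norm_mult)
    have hn: "summable (\<lambda>n. \<integral>x. norm (?h n x) \<partial>lborel)" using sum by (simp add: norm_mult)
    have "FT F y = (\<integral>x. (\<Sum>n. ?h n x) \<partial>lborel)"
      unfolding FT_def
    proof (rule integral_cong_AE)
      show "AE x in lborel. F x * cis (- (x * y)) = (\<Sum>n. ?h n x)"
        using AEs
      proof eventually_elim
        case (elim x)
        show ?case unfolding F_def by (rule suminf_mult2[OF summable_norm_cancel[OF elim]])
      qed
    qed (auto simp: F_def [abs_def])
    also have "\<dots> = (\<Sum>n. FT (f n) y)"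
      unfolding FT_def by (rule integral_suminf[OF h hs hn])
    also have "\<dots> = (\<Sum>n. g y * g y ^ n)" by (simp add: f)
    also have "\<dots> = g y / (1 - g y)"
    proof -
      have n: "norm (g y) < 1" using fourier_norm_le_bound[OF g, of y] q by simp
      show ?thesis
        using suminf_mult[OF summable_geometric[OF n], of "g y"] suminf_geometric[OF n] by simp
    qed
    finally show ?thesis .
  qed
  have "integrable lborel F"
    unfolding F_def [abs_def] by (rule integrable_suminf[OF f(1) AEs sum])
  with FT show ?thesis
    by (auto simp: fourier_norm_le_def)
qed

section \<open>The Fejer kernel and injectivity of the Fourier transform\<close>

text \<open>
  Up to normalisation this is the Fejer kernel; \<open>1 / 2\<close> is its continuous value at \<open>0\<close>. It serves
  twice: as a summability kernel that is itself a superposition of cosines (\<open>fejer_eq_integral\<close>), and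
  as an integrable function whose transform, a multiple of \<open>tri\<close>, has compact support (\<open>FT_fejer\<close>).
\<close>

definition fejer :: "real \<Rightarrow> real" where
  "fejer x = (if x = 0 then 1 / 2 else (1 - cos x) / x\<^sup>2)"

definition tri :: "real \<Rightarrow> real" where
  "tri y = max 0 (1 - \<bar>y\<bar>)"

lemma tri_eq_abs: "tri y = (\<bar>y + 1\<bar> + \<bar>y - 1\<bar>) / 2 - \<bar>y\<bar>"
  by (auto simp: tri_def max_def abs_if)

lemma fejer_nonneg: "0 \<le> fejer x"
  by (auto simp: fejer_def)

lemma fejer_uminus: "fejer (- x) = fejer x"
  by (auto simp: fejer_def)

lemma fejer_measurable [measurable]: "fejer \<in> borel_measurable borel"
  unfolding fejer_def [abs_def] by measurable

lemma fejer_le: "fejer x \<le> 5 / 2 * inverse (1 + x\<^sup>2)"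
proof (cases "x = 0")
  case False
  have "1 - cos x = 2 * (sin (x / 2))\<^sup>2"
    using cos_double_sin[of "x / 2"] by simp
  moreover have "(sin (x / 2))\<^sup>2 \<le> (x / 2)\<^sup>2"
    using abs_sin_x_le_abs_x[of "x / 2"] by (simp only: abs_le_square_iff)
  ultimately have 1: "1 - cos x \<le> x\<^sup>2 / 2" by (simp add: power_divide)
  have 2: "(1 - cos x) * x\<^sup>2 \<le> 2 * x\<^sup>2"
    using cos_ge_minus_one[of x] by (intro mult_right_mono) auto
  have "(1 - cos x) * (1 + x\<^sup>2) \<le> 5 / 2 * x\<^sup>2"
    using 1 2 by (simp add: ring_distribs)
  moreover have "0 < 1 + x\<^sup>2" by (simp add: add_pos_nonneg)
  ultimately show ?thesis
    using False by (simp add: fejer_def divide_simps) (simp add: algebra_simps)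
qed (simp add: fejer_def)

lemma fejer_integrable: "integrable lborel fejer"
proof (rule Bochner_Integration.integrable_bound)
  have "integrable lborel (\<lambda>x::real. inverse (1 + x\<^sup>2))"
    using integrable_inverse_1_plus_square by (simp add: set_integrable_def)
  then show "integrable lborel (\<lambda>x::real. 5 / 2 * inverse (1 + x\<^sup>2))" by simp
  show "AE x in lborel. norm (fejer x) \<le> norm (5 / 2 * inverse (1 + x\<^sup>2))"
    using fejer_le fejer_nonneg by (auto intro!: AE_I2 order_trans[OF _ abs_ge_self])
qed simp

lemma fejer_integral_pos: "0 < (\<integral>x. fejer x \<partial>lborel)"
proof -
  have c1: "cos 1 < (1 :: real)"
    using cos_monotone_0_pi[of 0 1] pi_gt3 by simp
  have "0 < (1 - cos 1) / (4 :: real)" using c1 by simp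
  also have "\<dots> = (\<integral>x. indicator {1..2::real} x * ((1 - cos 1) / 4) \<partial>lborel)"
    by simp
  also have "\<dots> \<le> (\<integral>x. fejer x \<partial>lborel)"
  proof (rule integral_mono)
    fix x :: real
    show "indicator {1..2} x * ((1 - cos 1) / 4) \<le> fejer x"
    proof (cases "x \<in> {1..2}")
      case True
      have "cos x \<le> cos 1" using True pi_gt3 by (intro cos_monotone_0_pi_le) auto
      moreover have "x\<^sup>2 \<le> 2\<^sup>2" using True by (intro power_mono) auto
      ultimately have "(1 - cos 1) / 4 \<le> (1 - cos x) / x\<^sup>2"
        using True c1 by (intro frac_le) auto
      with True show ?thesis by (auto simp: fejer_def)
    qed (simp add: fejer_nonneg)
  qed (auto intro!: fejer_integrable integrable_mult_left integrable_real_indicator)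
  finally show ?thesis .
qed

text \<open>
  Scaling alone shows that \<open>\<integral>x. (1 - cos (a * x)) / x\<^sup>2\<close> is proportional to \<open>\<bar>a\<bar>\<close>. This gives the
  transform up to the factor \<open>\<integral>x. fejer x\<close>: by \<open>fejer_times_cos\<close> it is a second difference of such
  integrals, and by \<open>tri_eq_abs\<close> the triangle is the same second difference of the absolute value.
\<close>

lemma fejer_dilated_integral:
  "has_bochner_integral lborel (\<lambda>x. a\<^sup>2 * fejer (a * x)) (\<bar>a\<bar> * (\<integral>x. fejer x \<partial>lborel))"
proof (cases "a = 0")
  case False
  have "integrable lborel (\<lambda>x. fejer (a * x))"
    using lborel_integrable_real_affine[OF fejer_integrable False, of 0] by simp
  moreover have "a\<^sup>2 * (\<integral>x. fejer (a * x) \<partial>lborel) = \<bar>a\<bar> * (\<integral>x. fejer x \<partial>lborel)"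
    using lborel_integral_real_affine[OF False, of fejer 0] False by (simp add: power2_eq_square)
  ultimately show ?thesis by (simp add: has_bochner_integral_iff)
qed (simp add: has_bochner_integral_zero)

lemma fejer_times_cos:
  "fejer x * cos (x * y) = ((y + 1)\<^sup>2 * fejer ((y + 1) * x) + (y - 1)\<^sup>2 * fejer ((y - 1) * x)) / 2 - y\<^sup>2 * fejer (y * x)"
proof (cases "x = 0")
  case True
  then show ?thesis by (simp add: fejer_def power2_eq_square field_simps)
next
  case False
  have *: "a\<^sup>2 * fejer (a * x) = (1 - cos (a * x)) / x\<^sup>2" for a
    using False by (cases "a = 0") (auto simp: fejer_def power_mult_distrib)
  have E: "cos ((y + 1) * x) + cos ((y - 1) * x) = 2 * (cos (x * y) * cos x)"
    by (simp add: ring_distribs cos_add cos_diff mult_ac)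
  have G: "((1 - A) / x\<^sup>2 + (1 - B) / x\<^sup>2) / 2 - (1 - D) / x\<^sup>2 = (2 * D - (A + B)) / (2 * x\<^sup>2)" for A B D :: real
    by (simp add: diff_divide_distrib add_divide_distrib)
  show ?thesis
    unfolding * G E using False by (simp add: fejer_def mult_ac algebra_simps diff_divide_distrib)
qed

lemma FT_fejer: "FT (\<lambda>x. of_real (fejer x)) y = of_real (tri y * (\<integral>x. fejer x \<partial>lborel))"
proof -
  let ?C = "\<integral>x. fejer x \<partial>lborel" and ?f = "\<lambda>x. of_real (fejer x) :: complex"
  have i: "integrable lborel ?f" using fejer_integrable by simp
  have "has_bochner_integral lborel (\<lambda>x. fejer x * cos (x * y))
      ((\<bar>y + 1\<bar> * ?C + \<bar>y - 1\<bar> * ?C) / 2 - \<bar>y\<bar> * ?C)"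
    unfolding fejer_times_cos
    by (intro has_bochner_integral_diff has_bochner_integral_divide_zero has_bochner_integral_add fejer_dilated_integral)
  then have c: "(\<integral>x. fejer x * cos (x * y) \<partial>lborel) = tri y * ?C"
    by (simp add: has_bochner_integral_iff tri_eq_abs algebra_simps add_divide_distrib)
  have "FT ?f (- y) = FT ?f y"
    using FT_reflect[of ?f y] by (simp add: fejer_uminus)
  \<comment> \<open>Averaging over \<open>y\<close> and \<open>- y\<close> replaces the complex exponential by a cosine.\<close>
  then have "2 * FT ?f y = FT ?f y + FT ?f (- y)" by simp
  also have "\<dots> = (\<integral>x. ?f x * cis (- (x * y)) + ?f x * cis (- (x * (- y))) \<partial>lborel)"
    unfolding FT_def by (intro Bochner_Integration.integral_add[symmetric] integrable_FT i)
  also have "\<dots> = (\<integral>x. 2 * of_real (fejer x * cos (x * y)) \<partial>lborel)"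
    by (intro Bochner_Integration.integral_cong) (auto simp: complex_eq_iff)
  also have "\<dots> = 2 * of_real (tri y * ?C)"
    by (simp only: integral_mult_right_zero integral_complex_of_real c)
  finally show ?thesis by simp
qed

lemma fejer_eq_integral: "fejer x = (\<integral>t. indicator {0..1} t * ((1 - t) * cos (x * t)) \<partial>lborel)"
proof -
  have "(\<integral>t. indicator {0..1} t *\<^sub>R ((1 - t) * cos (x * t)) \<partial>lborel) = fejer x"
  proof (cases "x = 0")
    case True
    have "(\<integral>t. indicator {0..1} t *\<^sub>R (1 - t) \<partial>lborel) = (1 - 1\<^sup>2 / 2) - (0 - 0\<^sup>2 / 2 :: real)"
      by (rule integral_FTC_Icc) (auto intro!: derivative_eq_intros continuous_intros
            simp flip: has_real_derivative_iff_has_vector_derivative)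
    then show ?thesis by (simp add: True fejer_def)
  next
    case False
    let ?G = "\<lambda>t. (1 - t) * sin (x * t) / x - cos (x * t) / x\<^sup>2"
    have "(\<integral>t. indicator {0..1} t *\<^sub>R ((1 - t) * cos (x * t)) \<partial>lborel) = ?G 1 - ?G 0"
      by (rule integral_FTC_Icc) (use False in \<open>auto intro!: derivative_eq_intros continuous_intros
            simp: field_simps power2_eq_square simp flip: has_real_derivative_iff_has_vector_derivative\<close>)
    then show ?thesis using False by (simp add: fejer_def diff_divide_distrib)
  qed
  then show ?thesis by simp
qed

text \<open>
  The kernel is a superposition of cosines, and the convolution of \<open>f\<close> with the functions
  \<open>x \<mapsto> cos (x * r)\<close> is a combination of \<open>FT f r\<close> and \<open>FT f (- r)\<close>.
\<close>

lemma conv_fejer_eq_0: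
  assumes f: "integrable lborel f" and z: "\<And>y. FT f y = 0"
  shows "conv (\<lambda>x. of_real (fejer (x / s)) / of_real s) f x = 0"
proof -
  let ?i = "\<lambda>t. indicator {0..1} t * (1 - t) :: real"
  have [measurable]: "f \<in> borel_measurable borel" using f by auto
  have cosint: "(\<integral>u. f u * of_real (cos ((x - u) * r)) \<partial>lborel) = 0" for r
  proof -
    have "(\<integral>u. f u * of_real (cos ((x - u) * r)) \<partial>lborel) =
        (\<integral>u. cis (x * r) / 2 * (f u * cis (- (u * r))) + cis (- (x * r)) / 2 * (f u * cis (- (u * (- r)))) \<partial>lborel)"
    proof (intro Bochner_Integration.integral_cong refl)
      fix u
      have "of_real (cos ((x - u) * r)) = (cis ((x - u) * r) + cis (- ((x - u) * r))) / 2"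
        by (simp add: complex_eq_iff)
      also have "\<dots> = (cis (x * r) * cis (- (u * r)) + cis (- (x * r)) * cis (- (u * (- r)))) / 2"
        by (simp add: cis_mult algebra_simps)
      finally show "f u * of_real (cos ((x - u) * r)) =
          cis (x * r) / 2 * (f u * cis (- (u * r))) + cis (- (x * r)) / 2 * (f u * cis (- (u * (- r))))"
        by (simp add: field_simps)
    qed
    also have "\<dots> = cis (x * r) / 2 * FT f r + cis (- (x * r)) / 2 * FT f (- r)"
      unfolding FT_def
      by (subst Bochner_Integration.integral_add[OF integrable_mult_right[OF integrable_FT[OF f]] integrable_mult_right[OF integrable_FT[OF f]]])
         (simp only: integral_mult_right_zero)
    finally show ?thesis by (simp add: z)
  qed
  have "integrable (lborel \<Otimes>\<^sub>M lborel) (\<lambda>(u, t). f u * of_real (?i t))"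
  proof (rule lborel_pair.Fubini_integrable)
    have "continuous_on {0..1} (\<lambda>t::real. 1 - t)" by (intro continuous_intros)
    from borel_integrable_atLeastAtMost'[OF this] have i: "integrable lborel ?i"
      by (simp add: set_integrable_def)
    show "integrable lborel (\<lambda>u. \<integral>t. norm (case (u, t) of (u, t) \<Rightarrow> f u * of_real (?i t)) \<partial>lborel)"
      using f by (simp add: norm_mult)
    show "AE u in lborel. integrable lborel (\<lambda>t. case (u, t) of (u, t) \<Rightarrow> f u * of_real (?i t))"
      using i by (simp only: prod.case) (intro AE_I2 integrable_mult_right integrable_of_real)
  qed measurable
  from integrable_mult_unimodular[OF this, of "\<lambda>(u, t). of_real (cos ((x - u) / s * t))"]
  have I: "integrable (lborel \<Otimes>\<^sub>M lborel) (\<lambda>(u, t). f u * of_real (?i t * cos ((x - u) / s * t)))"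
    by (simp add: case_prod_unfold mult.assoc)
  have "conv (\<lambda>x. of_real (fejer (x / s)) / of_real s) f x = (\<integral>u. of_real (fejer ((x - u) / s)) / of_real s * f u \<partial>lborel)"
    unfolding conv_def by (subst lborel_integral_real_affine[of "-1" _ x]) auto
  also have "\<dots> = (\<integral>u. (\<integral>t. f u * of_real (?i t * cos ((x - u) / s * t)) \<partial>lborel) \<partial>lborel) / of_real s"
    by (simp add: fejer_eq_integral mult_ac flip: integral_complex_of_real)
  also have "\<dots> = (\<integral>t. (\<integral>u. f u * of_real (?i t * cos ((x - u) / s * t)) \<partial>lborel) \<partial>lborel) / of_real s"
    by (subst lborel_pair.Fubini_integral[OF I]) simp
  also have "\<dots> = (\<integral>t. of_real (?i t) * (\<integral>u. f u * of_real (cos ((x - u) * (t / s))) \<partial>lborel) \<partial>lborel) / of_real s"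
    by (simp add: mult_ac flip: integral_mult_right_zero)
  also have "\<dots> = 0" by (simp only: cosint) simp
  finally show ?thesis .
qed

text \<open>
  If \<open>FT f\<close> vanishes, then so do all convolutions of \<open>f\<close> with dilated Fejer kernels, but these
  converge in \<open>L1\<close> to a positive multiple of \<open>f\<close>.
\<close>

theorem FT_injective:
  assumes f: "integrable lborel f" and z: "\<And>y. FT f y = 0"
  shows "AE x in lborel. f x = 0"
proof -
  let ?C = "\<integral>x. fejer x \<partial>lborel" and ?f = "\<lambda>x. of_real (fejer x) :: complex"
  have "?C * (\<integral>x. norm (f x) \<partial>lborel) \<le> 0 + e" if "e > 0" for e
  proof -
    have i: "integrable lborel ?f" using fejer_integrable by simp
    from approximate_identity[OF i f \<open>e > 0\<close>] i
    obtain s where "(\<integral>x. norm (conv (\<lambda>x. ?f (x / s) / of_real s) f x - FT ?f 0 * f x) \<partial>lborel) \<le> e"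
      by blast
    then show ?thesis
      using fejer_integral_pos by (simp add: conv_fejer_eq_0[OF f z] FT_fejer tri_def norm_mult)
  qed
  then have "?C * (\<integral>x. norm (f x) \<partial>lborel) \<le> 0" by (rule field_le_epsilon)
  then have "(\<integral>x. norm (f x) \<partial>lborel) \<le> 0"
    using fejer_integral_pos by (simp add: mult_le_0_iff)
  moreover have "0 \<le> (\<integral>x. norm (f x) \<partial>lborel)" by simp
  ultimately have "(\<integral>x. norm (f x) \<partial>lborel) = 0" by linarith
  then show ?thesis
    using f by (subst (asm) integral_nonneg_eq_0_iff_AE) auto
qed

lemma FT_unique:
  assumes "integrable lborel F" "integrable lborel G" "\<And>y. FT F y = FT G y"
  shows "AE x in lborel. F x = G x"
proof -
  have "AE x in lborel. F x - G x = 0"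
    by (rule FT_injective) (use assms in \<open>auto simp: FT_diff\<close>)
  then show ?thesis by simp
qed

section \<open>Wiener inversion\<close>

definition fourier_algebra :: "(real \<Rightarrow> complex) set" where
  "fourier_algebra = {g. \<exists>r. fourier_norm_le g r}"

lemma FT_in_fourier_algebra: "integrable lborel f \<Longrightarrow> FT f \<in> fourier_algebra"
  unfolding fourier_algebra_def fourier_norm_le_def by blast

lemma fourier_algebra_add: "g \<in> fourier_algebra \<Longrightarrow> h \<in> fourier_algebra \<Longrightarrow> (\<lambda>y. g y + h y) \<in> fourier_algebra"
  unfolding fourier_algebra_def using fourier_norm_le_add by blast

lemma fourier_algebra_cmult: "g \<in> fourier_algebra \<Longrightarrow> (\<lambda>y. c * g y) \<in> fourier_algebra"
  unfolding fourier_algebra_def using fourier_norm_le_cmult by blast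

lemma fourier_algebra_diff:
  assumes "g \<in> fourier_algebra" "h \<in> fourier_algebra"
  shows "(\<lambda>y. g y - h y) \<in> fourier_algebra"
  using fourier_algebra_add[OF assms(1) fourier_algebra_cmult[OF assms(2), of "-1"]] by simp

lemma fourier_algebra_mult: "g \<in> fourier_algebra \<Longrightarrow> h \<in> fourier_algebra \<Longrightarrow> (\<lambda>y. g y * h y) \<in> fourier_algebra"
  unfolding fourier_algebra_def using fourier_norm_le_mult by blast

lemma fourier_algebra_affine: "g \<in> fourier_algebra \<Longrightarrow> s > 0 \<Longrightarrow> (\<lambda>y. g (s * y + c)) \<in> fourier_algebra"
  unfolding fourier_algebra_def using fourier_norm_le_affine by blast

lemma fourier_algebra_sum:
  assumes "finite I" "\<And>i. i \<in> I \<Longrightarrow> g i \<in> fourier_algebra"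
  shows "(\<lambda>y. \<Sum>i\<in>I. g i y) \<in> fourier_algebra"
  using assms
proof (induction I rule: finite_induct)
  case empty
  have "fourier_norm_le (\<lambda>y. 0) 0" by (rule fourier_norm_leI[of "\<lambda>x. 0"]) (auto simp: FT_def)
  then show ?case by (auto simp: fourier_algebra_def)
qed (simp add: fourier_algebra_add)

text \<open>
  Near \<open>1\<close> inversion is a Neumann series. The inverse \<open>1 / (1 + q)\<close> itself is not a Fourier transform of
  an integrable function, since it does not vanish at infinity; \<open>q / (1 + q)\<close> is the part of it
  in the algebra: \<open>1 / (1 + q) = 1 - q / (1 + q)\<close>.
\<close>

lemma fourier_algebra_small_inverse:
  assumes "fourier_norm_le q (1 / 2)"
  shows "(\<lambda>y. q y / (1 + q y)) \<in> fourier_algebra" "1 / 2 \<le> norm (1 + q y)"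
proof -
  have "fourier_norm_le (\<lambda>y. - q y) (1 / 2)" using fourier_norm_le_cmult[OF assms, of "-1"] by simp
  from fourier_norm_le_neumann[OF this] have "(\<lambda>y. - q y / (1 - - q y)) \<in> fourier_algebra"
    by (simp add: fourier_algebra_def)
  from fourier_algebra_cmult[OF this, of "-1"] show "(\<lambda>y. q y / (1 + q y)) \<in> fourier_algebra" by simp
  show "1 / 2 \<le> norm (1 + q y)"
    using fourier_norm_le_bound[OF assms, of y] norm_diff_ineq[of 1 "q y"] by simp
qed

lemma tri_fourier_algebra: "(\<lambda>y. of_real (tri y)) \<in> fourier_algebra"
proof -
  let ?C = "\<integral>x. fejer x \<partial>lborel" and ?f = "\<lambda>x. of_real (fejer x) :: complex"
  have "FT ?f \<in> fourier_algebra"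
    using fejer_integrable by (intro FT_in_fourier_algebra) simp
  from fourier_algebra_cmult[OF this, of "1 / of_real ?C"] show ?thesis
    using fejer_integral_pos by (simp add: FT_fejer)
qed

definition trapezoid :: "real \<Rightarrow> real" where
  "trapezoid y = 2 * tri (y / 2) - tri y"

lemma trapezoid_eq_1: "\<bar>y\<bar> \<le> 1 \<Longrightarrow> trapezoid y = 1"
  by (auto simp: trapezoid_def tri_def max_def)

lemma trapezoid_eq_0: "2 \<le> \<bar>y\<bar> \<Longrightarrow> trapezoid y = 0"
  by (auto simp: trapezoid_def tri_def max_def)

lemma trapezoid_FT: "\<exists>v. integrable lborel v \<and> (\<forall>y. FT v y = of_real (trapezoid y))"
proof -
  have "(\<lambda>y. of_real (tri (1 / 2 * y + 0)) :: complex) \<in> fourier_algebra"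
    by (rule fourier_algebra_affine[OF tri_fourier_algebra]) simp
  from fourier_algebra_diff[OF fourier_algebra_cmult[OF this, of 2] tri_fourier_algebra]
  have "(\<lambda>y. of_real (trapezoid y)) \<in> fourier_algebra"
    by (simp add: trapezoid_def)
  then show ?thesis by (auto simp: fourier_algebra_def fourier_norm_le_def)
qed

text \<open>
  In a sufficiently small neighbourhood of a frequency \<open>c\<close>, the transform differs from the constant
  \<open>FT k c\<close> by little, not only in the supremum norm but in the norm of \<open>A\<close>. The size of the
  neighbourhood does not depend on \<open>c\<close>, which will allow a partition of unity of one width. Modulation
  moves \<open>c\<close> to the origin, where the dilated function is convolved with the preimage of the trapezoid.
\<close>

lemma FT_local_variation_small:
  assumes k: "integrable lborel k" and e: "e > 0"
  shows "\<exists>s>0. \<forall>c. fourier_norm_le (\<lambda>y. (FT k y - FT k c) * of_real (trapezoid ((y - c) / s))) e"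
proof -
  obtain v where v: "integrable lborel v" "\<And>y. FT v y = of_real (trapezoid y)"
    using trapezoid_FT by auto
  obtain s where s: "s > 0" and
    *: "\<And>a'. integrable lborel a' \<Longrightarrow> (\<And>x. norm (a' x) = norm (k x)) \<Longrightarrow>
      (\<integral>x. norm (conv (\<lambda>x. a' (x / s) / of_real s) v x - FT a' 0 * v x) \<partial>lborel) \<le> e"
    using approximate_identity[OF k v(1) e] by blast
  show ?thesis
  proof (intro exI conjI allI)
    fix c :: real
    let ?a = "\<lambda>x. k x * cis (x * (- c))"
    let ?b = "\<lambda>x. ?a (x / s) / of_real s"
    have a: "integrable lborel ?a" using k by (intro integrable_mult_unimodular) auto
    note b = integrable_dilate[OF a s]
    have FT_b: "FT ?b y = FT k (s * y + c)" for y
      by (subst FT_dilate[OF s], subst FT_modulate) simp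
    have FT_a: "FT ?a 0 = FT k c" by (subst FT_modulate) simp
    have "fourier_norm_le (\<lambda>y. (FT k (s * y + c) - FT k c) * of_real (trapezoid y)) e"
    proof (rule fourier_norm_leI)
      show "integrable lborel (\<lambda>x. conv ?b v x - FT ?a 0 * v x)"
        by (intro Bochner_Integration.integrable_diff integrable_conv b v integrable_mult_right)
      show "(\<integral>x. norm (conv ?b v x - FT ?a 0 * v x) \<partial>lborel) \<le> e"
        by (rule *[OF a]) (simp add: norm_mult)
      show "FT (\<lambda>x. conv ?b v x - FT ?a 0 * v x) y = (FT k (s * y + c) - FT k c) * of_real (trapezoid y)" for y
        by (simp only: FT_diff[OF integrable_conv[OF b v(1)] integrable_mult_right[OF v(1)]]
              FT_conv[OF b v(1)] FT_cmult FT_b FT_a v(2) ring_distribs)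
    qed
    from fourier_norm_le_affine[OF this, of "1 / s" "- c / s"] s
    show "fourier_norm_le (\<lambda>y. (FT k y - FT k c) * of_real (trapezoid ((y - c) / s))) e"
      by (simp add: field_simps)
  qed fact
qed

text \<open>
  Here the preimage of the trapezoid is the approximate identity: convolution with a concentrated
  copy of it changes \<open>k\<close> little and multiplies the transform by a wide trapezoid.
\<close>

lemma FT_tail_small:
  assumes k: "integrable lborel k" and e: "e > 0"
  shows "\<exists>s>0. fourier_norm_le (\<lambda>y. FT k y * (1 - of_real (trapezoid (s * y)))) e"
proof -
  obtain v where v: "integrable lborel v" "\<And>y. FT v y = of_real (trapezoid y)"
    using trapezoid_FT by auto
  obtain s where s: "s > 0" and
    *: "(\<integral>x. norm (conv (\<lambda>x. v (x / s) / of_real s) k x - FT v 0 * k x) \<partial>lborel) \<le> e"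
    using approximate_identity[OF v(1) k e] v(1) by blast
  let ?b = "\<lambda>x. v (x / s) / of_real s"
  note b = integrable_dilate[OF v(1) s]
  have "fourier_norm_le (\<lambda>y. (of_real (trapezoid (s * y)) - 1) * FT k y) e"
  proof (rule fourier_norm_leI)
    show "integrable lborel (\<lambda>x. conv ?b k x - FT v 0 * k x)"
      by (intro Bochner_Integration.integrable_diff integrable_conv b k integrable_mult_right)
    show "FT (\<lambda>x. conv ?b k x - FT v 0 * k x) y = (of_real (trapezoid (s * y)) - 1) * FT k y" for y
      using b k by (subst FT_diff) (auto intro!: integrable_conv integrable_mult_right
          simp: FT_cmult FT_conv FT_dilate[OF s] v trapezoid_eq_1 ring_distribs)
  qed fact
  from fourier_norm_le_cmult[OF this, of "-1"] show ?thesis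
    using s by (auto simp: algebra_simps)
qed

text \<open>
  Unit shifts of \<open>tri\<close> form a partition of unity. As a second difference of the absolute value, the
  partial sums telescope.
\<close>

lemma sum_tri:
  assumes "\<bar>z\<bar> \<le> real N"
  shows "(\<Sum>i\<le>2 * N. tri (z + real N - real i)) = 1"
proof -
  have "(\<Sum>i\<le>n. tri (w - real i)) = ((\<bar>w + 1\<bar> - \<bar>w\<bar>) - (\<bar>w - real n\<bar> - \<bar>w - real n - 1\<bar>)) / 2" for w n
  proof (induction n)
    case (Suc n)
    then show ?case by (simp add: tri_eq_abs[of "w - (1 + real n)"] field_simps)
  qed (simp add: tri_eq_abs field_simps)
  from this[of "z + real N" "2 * N"] show ?thesis using assms by (auto simp: abs_if split: if_splits)
qed

text \<open>
  Write \<open>F = 1 + FT k\<close> and \<open>H = 1 - 1 / F\<close>. Locally \<open>H\<close> agrees with an element of \<open>A\<close>: near a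
  frequency \<open>c\<close>, the quotient \<open>F / F c\<close> is close to \<open>1\<close> in the norm of \<open>A\<close>, so that it is inverted by
  a Neumann series, and outside a bounded interval \<open>F\<close> itself is close to \<open>1\<close>. Since the
  neighbourhoods may be taken of one size \<open>s\<close>, finitely many shifts of the triangle of width \<open>s\<close> and
  the complement of their sum glue these local representations together; each triangle lies in \<open>A\<close>.
\<close>

theorem wiener_inversion:
  assumes k: "integrable lborel k" and nz: "\<And>y. 1 + FT k y \<noteq> 0"
  shows "\<exists>L. integrable lborel L \<and> (\<forall>y. FT L y = FT k y / (1 + FT k y))"
proof -
  define F where "F y = 1 + FT k y" for y
  define H where "H y = FT k y / (1 + FT k y)" for y
  have H: "H y = 1 - 1 / F y" for y
    using nz[of y] by (simp add: H_def F_def field_simps)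
  \<comment> \<open>Beyond \<open>R\<close> the trapezoid vanishes, so \<open>F = 1 + q\<close> there with \<open>q\<close> of norm at most \<open>1 / 2\<close> in \<open>A\<close>.\<close>
  obtain \<sigma> where \<sigma>: "\<sigma> > 0"
    and q: "fourier_norm_le (\<lambda>y. FT k y * (1 - of_real (trapezoid (\<sigma> * y)))) (1 / 2)" (is "fourier_norm_le ?q _")
    using FT_tail_small[OF k, of "1/2"] by auto
  define R where "R = 2 / \<sigma>"
  have q_eq: "?q y = FT k y" if "\<bar>y\<bar> \<ge> R" for y
  proof -
    have "2 \<le> \<bar>\<sigma> * y\<bar>" using that \<sigma> by (simp add: R_def abs_mult field_simps)
    then show ?thesis by (simp add: trapezoid_eq_0)
  qed
  \<comment> \<open>\<open>F\<close> is bounded away from \<open>0\<close>: near infinity by \<open>1 / 2\<close>, on \<open>{-R..R}\<close> by compactness.\<close>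
  obtain \<delta> where \<delta>: "\<delta> > 0" "\<And>y. \<delta> \<le> norm (F y)"
  proof -
    have "continuous_on {-R..R} (\<lambda>y. norm (F y))"
      unfolding F_def by (intro continuous_intros continuous_on_subset[OF continuous_on_FT[OF k]]) auto
    moreover have "{-R..R} \<noteq> {}" using \<sigma> by (simp add: R_def)
    ultimately obtain y0 where y0: "\<And>y. y \<in> {-R..R} \<Longrightarrow> norm (F y0) \<le> norm (F y)"
      using continuous_attains_inf[of "{-R..R}" "\<lambda>y. norm (F y)"] by (metis compact_Icc)
    show ?thesis
    proof (rule that[of "min (1 / 2) (norm (F y0))"])
      show "0 < min (1 / 2) (norm (F y0))" using nz[of y0] by (simp add: F_def)
      fix y show "min (1 / 2) (norm (F y0)) \<le> norm (F y)"
      proof (cases "\<bar>y\<bar> \<ge> R")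
        case True
        with fourier_algebra_small_inverse(2)[OF q, of y] q_eq[of y] show ?thesis by (simp add: F_def)
      next
        case False
        then have "norm (F y0) \<le> norm (F y)" by (intro y0) auto
        then show ?thesis by simp
      qed
    qed
  qed
  obtain s where s: "s > 0" and
    loc: "\<And>c. fourier_norm_le (\<lambda>y. (FT k y - FT k c) * of_real (trapezoid ((y - c) / s))) (\<delta> / 2)"
    using FT_local_variation_small[OF k, of "\<delta>/2"] \<delta> by auto
  \<comment> \<open>On the support of the triangle the trapezoid is \<open>1\<close>, hence \<open>F = F c * (1 + r)\<close> with \<open>r\<close> small in \<open>A\<close>.\<close>
  have local: "(\<lambda>y. of_real (tri ((y - c) / s)) * H y) \<in> fourier_algebra" for c
  proof -
    let ?r = "\<lambda>y. 1 / F c * ((FT k y - FT k c) * of_real (trapezoid ((y - c) / s)))"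
    let ?t = "\<lambda>y. of_real (tri ((y - c) / s)) :: complex"
    have Fc: "F c \<noteq> 0" using nz[of c] by (simp add: F_def)
    have "norm (1 / F c) * (\<delta> / 2) \<le> 1 / 2"
      using \<delta>(2)[of c] Fc by (simp add: norm_divide field_simps)
    then have r: "fourier_norm_le ?r (1 / 2)"
      using fourier_norm_le_cmult[OF loc[of c], of "1 / F c"]
      unfolding fourier_norm_le_def using order_trans by blast
    note n = fourier_algebra_small_inverse(1)[OF r]
    have t: "?t \<in> fourier_algebra"
      using fourier_algebra_affine[OF tri_fourier_algebra, of "1 / s" "- c / s"] s
      by (simp add: field_simps)
    have "(\<lambda>y. (1 - 1 / F c) * ?t y + 1 / F c * (?t y * (?r y / (1 + ?r y)))) \<in> fourier_algebra"
      by (intro fourier_algebra_add fourier_algebra_cmult fourier_algebra_mult t n)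
    also have "(\<lambda>y. (1 - 1 / F c) * ?t y + 1 / F c * (?t y * (?r y / (1 + ?r y)))) = (\<lambda>y. ?t y * H y)"
    proof
      fix y
      show "(1 - 1 / F c) * ?t y + 1 / F c * (?t y * (?r y / (1 + ?r y))) = ?t y * H y"
      proof (cases "\<bar>(y - c) / s\<bar> \<le> 1")
        case True
        then have r: "1 + ?r y = F y / F c"
          using Fc by (simp add: trapezoid_eq_1 F_def field_simps)
        have Fy: "F y \<noteq> 0" using nz[of y] by (simp add: F_def)
        have "?r y / (1 + ?r y) = (F y / F c - 1) / (F y / F c)" using r by (metis add_diff_cancel_left')
        also have "\<dots> = 1 - F c / F y" using Fc Fy by (simp add: field_simps)
        finally have "(1 - 1 / F c) * ?t y + 1 / F c * (?t y * (?r y / (1 + ?r y))) =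
          (1 - 1 / F c) * ?t y + 1 / F c * (?t y * (1 - F c / F y))" by simp
        also have "\<dots> = ?t y * (1 - 1 / F y)" using Fc Fy by (simp add: field_simps)
        finally show ?thesis by (simp add: H)
      next
        case False
        then have "?t y = 0" by (simp add: tri_def)
        then show ?thesis by simp
      qed
    qed
    finally show ?thesis .
  qed
  obtain N :: nat where N: "R / s \<le> real N" using real_arch_simple by blast
  let ?S = "\<lambda>y. \<Sum>i\<le>2 * N. of_real (tri ((y - (real i - real N) * s) / s)) :: complex"
  let ?n = "\<lambda>y. ?q y / (1 + ?q y)"
  note n = fourier_algebra_small_inverse(1)[OF q]
  \<comment> \<open>Since the triangles sum to \<open>1\<close> on \<open>{-R..R}\<close>, the factor \<open>1 - S\<close> sees \<open>H\<close> only where it equals \<open>q / (1 + q)\<close>.\<close>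
  have S1: "?S y = 1" if "\<bar>y\<bar> \<le> R" for y
  proof -
    have "\<bar>y\<bar> / s \<le> R / s" using that s by (simp add: divide_right_mono)
    then have "\<bar>y / s\<bar> \<le> real N" using N s by simp
    moreover have "(y - (real i - real N) * s) / s = y / s + real N - real i" for i
      using s by (simp add: field_simps)
    ultimately show ?thesis using sum_tri[of "y / s" N] by (simp flip: of_real_sum)
  qed
  have tri: "(\<lambda>y. of_real (tri ((y - c) / s)) :: complex) \<in> fourier_algebra" for c
    using fourier_algebra_affine[OF tri_fourier_algebra, of "1 / s" "- c / s"] s
    by (simp add: field_simps)
  have "(\<lambda>y. (\<Sum>i\<le>2 * N. of_real (tri ((y - (real i - real N) * s) / s)) * H y) + (?n y - ?S y * ?n y)) \<in> fourier_algebra"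
    by (intro fourier_algebra_add fourier_algebra_diff fourier_algebra_mult fourier_algebra_sum local n tri) auto
  also have "(\<lambda>y. (\<Sum>i\<le>2 * N. of_real (tri ((y - (real i - real N) * s) / s)) * H y) + (?n y - ?S y * ?n y)) = H"
  proof
    fix y
    have "?S y * H y + (?n y - ?S y * ?n y) = H y"
    proof (cases "\<bar>y\<bar> \<le> R")
      case True
      show ?thesis unfolding S1[OF True] by simp
    next
      case False
      then have "?q y = FT k y" by (intro q_eq) simp
      then have "?n y = H y" unfolding H_def by (simp only:)
      then show ?thesis by simp
    qed
    then show "(\<Sum>i\<le>2 * N. of_real (tri ((y - (real i - real N) * s) / s)) * H y) + (?n y - ?S y * ?n y) = H y"
      by (simp only: sum_distrib_right)
  qed
  finally show ?thesis
    by (auto simp: fourier_algebra_def fourier_norm_le_def H_def [abs_def])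
qed

section \<open>Functions on the half-line\<close>

text \<open>
  Fubini's theorem and the substitution rules are at hand for Borel functions and \<open>lborel\<close>. Functions
  on the half-line are therefore replaced by Borel versions that are extended by \<open>0\<close> to the whole
  line; from these the odd and the even extension are obtained by reflection.
\<close>

lemma lebesgue_borel_version:
  fixes f :: "'a::euclidean_space \<Rightarrow> complex"
  assumes f: "f \<in> borel_measurable lebesgue"
  shows "\<exists>g\<in>borel_measurable borel. AE x in lborel. f x = g x"
proof -
  have "(\<lambda>x. Re (f x)) \<in> borel_measurable lebesgue" "(\<lambda>x. Im (f x)) \<in> borel_measurable lebesgue"
    using f by measurable
  from this[THEN completion_ex_borel_measurable_real]
  obtain a b where ab: "a \<in> borel_measurable lborel" "AE x in lborel. Re (f x) = a x"
      "b \<in> borel_measurable lborel" "AE x in lborel. Im (f x) = b x"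
    by blast
  show ?thesis
  proof (rule bexI[of _ "\<lambda>x. of_real (a x) + \<i> * of_real (b x)"])
    show "AE x in lborel. f x = of_real (a x) + \<i> * of_real (b x)"
      using ab(2,4) by eventually_elim (simp add: complex_eq_iff)
    show "(\<lambda>x. of_real (a x) + \<i> * of_real (b x)) \<in> borel_measurable borel"
      using ab(1,3) by simp
  qed
qed

lemma
  fixes G G0 :: "'a::euclidean_space \<Rightarrow> complex"
  assumes G0: "G0 \<in> borel_measurable borel" and eq: "AE z in lborel. G z = G0 z"
  shows integrable_lebesgue_iff_lborel: "integrable lebesgue G \<longleftrightarrow> integrable lborel G0"
    and integral_lebesgue_eq_lborel: "integral\<^sup>L lebesgue G = integral\<^sup>L lborel G0"
proof -
  have eq': "AE z in lebesgue. G z = G0 z" using eq by (simp add: AE_completion_iff)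
  have m0: "G0 \<in> borel_measurable lebesgue" using G0 by (simp add: measurable_completion)
  then have m: "G \<in> borel_measurable lebesgue"
    using eq' by (elim borel_measurable_AE) (auto elim: eventually_mono)
  show "integrable lebesgue G \<longleftrightarrow> integrable lborel G0"
    using integrable_cong_AE[OF m m0 eq'] integrable_completion[of G0 lborel] G0 by simp
  show "integral\<^sup>L lebesgue G = integral\<^sup>L lborel G0"
    using integral_cong_AE[OF m m0 eq'] integral_completion[of G0 lborel] G0 by simp
qed

lemma AE_real_affine:
  fixes P :: "real \<Rightarrow> bool"
  assumes "c \<noteq> 0" "AE x in lborel. P x"
  shows "AE x in lborel. P (t + c * x)"
proof -
  obtain N where N: "N \<in> null_sets lborel" "{x \<in> space lborel. \<not> P x} \<subseteq> N"
    using assms(2) unfolding eventually_ae_filter by blast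
  have [measurable]: "N \<in> sets borel" using N(1) by auto
  have "AE x in lborel. t + c * x \<notin> N"
    by (rule AE_borel_affine[OF assms(1)]) (use N(1) in \<open>auto intro: AE_not_in\<close>)
  then show ?thesis by eventually_elim (use N(2) in auto)
qed

definition half_line_rep :: "(real \<Rightarrow> complex) \<Rightarrow> (real \<Rightarrow> complex) \<Rightarrow> bool" where
  "half_line_rep f a \<longleftrightarrow> integrable lborel a \<and> (\<forall>x\<le>0. a x = 0) \<and> (AE x in lborel. x > 0 \<longrightarrow> f x = a x)"

text \<open>
  If \<open>a\<close> vanishes on the nonpositive reals, these are its odd and its even extension. For other
  functions they are still linear in \<open>a\<close>, with Fourier transforms \<open>FT a y - FT a (- y)\<close> and
  \<open>FT a y + FT a (- y)\<close>.
\<close>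

definition odd_ext :: "(real \<Rightarrow> complex) \<Rightarrow> real \<Rightarrow> complex" where
  "odd_ext a x = a x - a (- x)"

definition even_ext :: "(real \<Rightarrow> complex) \<Rightarrow> real \<Rightarrow> complex" where
  "even_ext a x = a x + a (- x)"

lemma half_line_AE_eq:
  fixes f a :: "real \<Rightarrow> complex"
  assumes "\<And>x. x \<le> 0 \<Longrightarrow> a x = 0" "AE x in lborel. x > 0 \<longrightarrow> f x = a x"
  shows "AE x in lborel. indicator {0..} x *\<^sub>R f x = a x"
  using assms(2) AE_lborel_singleton[of 0]
  by eventually_elim (use assms(1) in \<open>auto split: split_indicator\<close>)

lemma half_line_borel_version:
  fixes f :: "real \<Rightarrow> complex"
  assumes "set_borel_measurable lebesgue {0..} f"
  obtains a where "a \<in> borel_measurable borel" "\<And>x. x \<le> 0 \<Longrightarrow> a x = 0" "AE x in lborel. x > 0 \<longrightarrow> f x = a x"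
proof -
  obtain g where g: "g \<in> borel_measurable borel" "AE x in lborel. indicator {0..} x *\<^sub>R f x = g x"
    using lebesgue_borel_version[OF assms[unfolded set_borel_measurable_def]] by blast
  show ?thesis
  proof (rule that[of "\<lambda>x. if x > 0 then g x else 0"])
    show "AE x in lborel. x > 0 \<longrightarrow> f x = (if x > 0 then g x else 0)"
      using g(2) by eventually_elim auto
  qed (use g(1) in auto)
qed

lemma L1_iff_half_line_rep: "f \<in> L1 \<longleftrightarrow> (\<exists>a. half_line_rep f a)"
proof
  assume "f \<in> L1"
  then have i: "integrable lebesgue (\<lambda>x. indicator {0..} x *\<^sub>R f x)"
    by (simp add: L1_def set_integrable_def)
  then have "set_borel_measurable lebesgue {0..} f"
    by (auto simp: set_borel_measurable_def)
  then obtain a where a: "a \<in> borel_measurable borel" "\<And>x. x \<le> 0 \<Longrightarrow> a x = 0" "AE x in lborel. x > 0 \<longrightarrow> f x = a x"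
    using half_line_borel_version[of f] by metis
  with i have "integrable lborel a"
    using integrable_lebesgue_iff_lborel[OF a(1) half_line_AE_eq[OF a(2,3)]] by simp
  with a show "\<exists>a. half_line_rep f a" by (auto simp: half_line_rep_def)
next
  assume "\<exists>a. half_line_rep f a"
  then obtain a where a: "integrable lborel a" "\<And>x. x \<le> 0 \<Longrightarrow> a x = 0" "AE x in lborel. x > 0 \<longrightarrow> f x = a x"
    by (auto simp: half_line_rep_def)
  then show "f \<in> L1"
    using integrable_lebesgue_iff_lborel[OF _ half_line_AE_eq[OF a(2,3)]]
    by (auto simp: L1_def set_integrable_def)
qed

lemma integral_half_line:
  assumes a: "half_line_rep f a" and [measurable]: "g \<in> borel_measurable borel"
  shows "(LINT x:{0..}|lebesgue. g x * f x) = (\<integral>x. g x * a x \<partial>lborel)"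
  unfolding set_lebesgue_integral_def
proof (rule integral_lebesgue_eq_lborel)
  show "AE x in lborel. indicator {0..} x *\<^sub>R (g x * f x) = g x * a x"
    by (rule half_line_AE_eq) (use a in \<open>auto simp: half_line_rep_def elim: eventually_mono\<close>)
  show "(\<lambda>x. g x * a x) \<in> borel_measurable borel"
    using a by (auto simp: half_line_rep_def)
qed

lemma L1_norm_half_line_rep:
  assumes a: "half_line_rep f a"
  shows "L1_norm f = (\<integral>x. norm (a x) \<partial>lborel)"
proof -
  have [measurable]: "a \<in> borel_measurable borel" using a by (auto simp: half_line_rep_def)
  have "AE x in lborel. indicator {0..} x *\<^sub>R of_real (norm (f x)) = (of_real (norm (a x)) :: complex)"
    by (rule half_line_AE_eq) (use a in \<open>auto simp: half_line_rep_def elim: eventually_mono\<close>)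
  then have "(\<integral>x. indicator {0..} x *\<^sub>R of_real (norm (f x)) \<partial>lebesgue) = (\<integral>x. (of_real (norm (a x)) :: complex) \<partial>lborel)"
    by (intro integral_lebesgue_eq_lborel) auto
  also have "(\<lambda>x. indicator {0..} x *\<^sub>R of_real (norm (f x)) :: complex) = (\<lambda>x. of_real (indicator {0..} x *\<^sub>R norm (f x)))"
    by (auto split: split_indicator)
  finally show ?thesis
    by (simp add: L1_norm_def set_lebesgue_integral_def flip: of_real_mult)
qed

lemma integrable_odd_ext: "integrable lborel a \<Longrightarrow> integrable lborel (odd_ext a)"
  unfolding odd_ext_def [abs_def] by (intro Bochner_Integration.integrable_diff integrable_reflect_real)

lemma integrable_even_ext: "integrable lborel a \<Longrightarrow> integrable lborel (even_ext a)"
  unfolding even_ext_def [abs_def] by (intro Bochner_Integration.integrable_add integrable_reflect_real)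

lemma FT_odd_ext: "integrable lborel a \<Longrightarrow> FT (odd_ext a) y = FT a y - FT a (- y)"
  unfolding odd_ext_def [abs_def] by (simp add: FT_diff integrable_reflect_real FT_reflect)

lemma FT_even_ext: "integrable lborel a \<Longrightarrow> FT (even_ext a) y = FT a y + FT a (- y)"
  unfolding even_ext_def [abs_def] by (simp add: FT_add integrable_reflect_real FT_reflect)

lemma fourier_cos_eq_FT:
  assumes a: "half_line_rep f a"
  shows "fourier_cos f y = of_real (1 / sqrt (2 * pi)) * FT (even_ext a) y"
proof -
  have i: "integrable lborel a" using a by (auto simp: half_line_rep_def)
  have "FT (even_ext a) y = FT a y + FT a (- y)" by (rule FT_even_ext[OF i])
  also have "\<dots> = (\<integral>x. a x * cis (- (x * y)) + a x * cis (- (x * (- y))) \<partial>lborel)"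
    unfolding FT_def
    by (intro Bochner_Integration.integral_add[symmetric] integrable_FT i)
  also have "\<dots> = (\<integral>x. 2 * (of_real (cos (x * y)) * a x) \<partial>lborel)"
    by (intro Bochner_Integration.integral_cong) (auto simp: complex_eq_iff)
  also have "\<dots> = 2 * (\<integral>x. of_real (cos (x * y)) * a x \<partial>lborel)" by simp
  also have "(\<integral>x. of_real (cos (x * y)) * a x \<partial>lborel) = (LINT x:{0..}|lebesgue. of_real (cos (x * y)) * f x)"
    by (rule integral_half_line[OF a, symmetric]) measurable
  finally have "FT (even_ext a) y = 2 * (LINT x:{0..}|lebesgue. of_real (cos (x * y)) * f x)" .
  moreover have "sqrt (2 / pi) = 2 / sqrt (2 * pi)"
    by (simp add: real_sqrt_divide real_sqrt_mult field_simps)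
  ultimately show ?thesis by (simp add: fourier_cos_def)
qed

lemma FT_eq_of_odd_eq_on_half_line:
  assumes "integrable lborel F" "integrable lborel G" "\<And>x. F (- x) = - F x" "\<And>x. G (- x) = - G x"
    and eq: "AE x in lborel. x > 0 \<longrightarrow> F x = G x"
  shows "FT F y = FT G y"
proof (rule FT_cong_AE)
  have "AE x in lborel. - x > 0 \<longrightarrow> F (- x) = G (- x)"
    using AE_real_affine[OF _ eq, of "-1" 0] by simp
  with eq AE_lborel_singleton[of 0] show "AE x in lborel. F x = G x"
    by eventually_elim (use assms(3,4) in \<open>metis linorder_neqE_linordered_idom neg_0_less_iff_less neg_equal_iff_equal\<close>)
qed (use assms in auto)

lemma odd_ext_odd: "odd_ext a (- x) = - odd_ext a x"
  by (simp add: odd_ext_def)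

lemma even_ext_even: "even_ext a (- x) = even_ext a x"
  by (simp add: even_ext_def)

lemma conv_odd_even:
  assumes "\<And>x. F (- x) = - F x" "\<And>x. G (- x) = G x"
  shows "conv F G (- x) = - conv F G x"
proof -
  have "conv F G (- x) = (\<integral>u. F (- u) * G (- x - (- u)) \<partial>lborel)"
    unfolding conv_def by (rule integral_reflect_real[symmetric])
  also have "\<dots> = (\<integral>u. - (F u * G (x - u)) \<partial>lborel)"
    using assms(1) assms(2)[of "x - _"] by (intro Bochner_Integration.integral_cong) auto
  finally show ?thesis by (simp add: conv_def)
qed

text \<open>
  Folding the integral of \<open>conv (odd_ext a) (even_ext b) x\<close> at the origin gives the two terms
  \<open>g \<bar>x - u\<bar>\<close> and \<open>g (x + u)\<close> of Sneddon's convolution. The folding splits the integral in two, which is allowed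
  for almost every \<open>x\<close>, namely where both parts converge.
\<close>

lemma sneddon_conv_AE:
  assumes f: "half_line_rep f a" and g: "half_line_rep g b"
  shows "AE x in lborel. x > 0 \<longrightarrow>
    sneddon_conv f g x = of_real (1 / sqrt (2 * pi)) * conv (odd_ext a) (even_ext b) x"
proof -
  have a: "integrable lborel a" "\<And>x. x \<le> 0 \<Longrightarrow> a x = 0" "AE x in lborel. x > 0 \<longrightarrow> f x = a x"
    using f by (auto simp: half_line_rep_def)
  have b: "integrable lborel b" "\<And>x. x \<le> 0 \<Longrightarrow> b x = 0" "AE x in lborel. x > 0 \<longrightarrow> g x = b x"
    using g by (auto simp: half_line_rep_def)
  let ?E = "even_ext b"
  have [measurable]: "a \<in> borel_measurable borel" "?E \<in> borel_measurable borel"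
    using a(1) integrable_even_ext[OF b(1)] by auto
  note i = AE_integrable_conv[OF a(1) integrable_even_ext[OF b(1)]]
    AE_integrable_conv[OF integrable_reflect_real[OF a(1)] integrable_even_ext[OF b(1)]]
  have E: "?E v = g v" if "v > 0" "v > 0 \<longrightarrow> g v = b v" for v
    using that b(2)[of "- v"] by (simp add: even_ext_def)
  from i show ?thesis
  proof eventually_elim
    case (elim x)
    show ?case
    proof
      assume x: "x > 0"
      have R: "integrable lborel (\<lambda>u. a u * ?E (x + u))"
        using integrable_reflect_real[OF elim(2)] by simp
      have "AE u in lborel. x - u > 0 \<longrightarrow> g (x - u) = b (x - u)"
           "AE u in lborel. u - x > 0 \<longrightarrow> g (u - x) = b (u - x)"
           "AE u in lborel. x + u > 0 \<longrightarrow> g (x + u) = b (x + u)"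
        using AE_real_affine[OF _ b(3), of "-1" x] AE_real_affine[OF _ b(3), of 1 "-x"] AE_real_affine[OF _ b(3), of 1 x]
        by simp_all
      with AE_lborel_singleton[of x]
      have "AE u in lborel. u > 0 \<longrightarrow> g \<bar>x - u\<bar> - g (x + u) = ?E (x - u) - ?E (x + u)"
      proof eventually_elim
        case (elim u)
        show ?case
        proof
          assume u: "u > 0"
          have "?E (x + u) = g (x + u)" using x u elim by (intro E) auto
          moreover have "?E (x - u) = g \<bar>x - u\<bar>"
          proof (cases "u < x")
            case True
            then show ?thesis using elim E[of "x - u"] by simp
          next
            case False
            then show ?thesis using elim E[of "u - x"] even_ext_even[of b "x - u"] by simp
          qed
          ultimately show "g \<bar>x - u\<bar> - g (x + u) = ?E (x - u) - ?E (x + u)" by simp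
        qed
      qed
      with a(3) have "AE u in lborel. u > 0 \<longrightarrow> f u * (g \<bar>x - u\<bar> - g (x + u)) = a u * (?E (x - u) - ?E (x + u))"
        by eventually_elim auto
      then have "AE u in lborel. indicator {0..} u *\<^sub>R (f u * (g \<bar>x - u\<bar> - g (x + u))) = a u * (?E (x - u) - ?E (x + u))"
        using a(2) by (intro half_line_AE_eq) auto
      then have "(LINT u:{0..}|lebesgue. f u * (g \<bar>x - u\<bar> - g (x + u))) = (\<integral>u. a u * (?E (x - u) - ?E (x + u)) \<partial>lborel)"
        unfolding set_lebesgue_integral_def by (intro integral_lebesgue_eq_lborel) measurable
      also have "\<dots> = (\<integral>u. a u * ?E (x - u) \<partial>lborel) - (\<integral>u. a u * ?E (x + u) \<partial>lborel)"
        using elim(1) R by (simp add: right_diff_distrib)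
      also have "(\<integral>u. a u * ?E (x + u) \<partial>lborel) = (\<integral>u. a (- u) * ?E (x - u) \<partial>lborel)"
        using integral_reflect_real[of "\<lambda>u. a u * ?E (x + u)"] by simp
      also have "(\<integral>u. a u * ?E (x - u) \<partial>lborel) - \<dots> = conv (odd_ext a) ?E x"
        using elim by (simp add: conv_def odd_ext_def left_diff_distrib)
      finally show "sneddon_conv f g x = of_real (1 / sqrt (2 * pi)) * conv (odd_ext a) ?E x"
        by (simp add: sneddon_conv_def)
    qed
  qed
qed

text \<open>
  An odd function on the line is recovered from its restriction to the positive reals. The value at
  \<open>0\<close> also agrees, since oddness forces it to be \<open>0\<close>.
\<close>

lemma half_line_rep_odd:
  assumes F: "integrable lborel F" "\<And>x. F (- x) = - F x" and eq: "AE x in lborel. x > 0 \<longrightarrow> f x = F x"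
  shows "half_line_rep f (\<lambda>x. if x > 0 then F x else 0)"
    and "odd_ext (\<lambda>x. if x > 0 then F x else 0) = F"
proof -
  have "integrable lborel (\<lambda>x. indicator {0<..} x *\<^sub>R F x)"
    using F(1) by (intro integrable_mult_indicator) auto
  also have "(\<lambda>x. indicator {0<..} x *\<^sub>R F x) = (\<lambda>x. if x > 0 then F x else 0)"
    by (auto split: split_indicator)
  finally show "half_line_rep f (\<lambda>x. if x > 0 then F x else 0)"
    using eq by (auto simp: half_line_rep_def elim: eventually_mono)
  have "F 0 = 0" using F(2)[of 0] by simp
  then show "odd_ext (\<lambda>x. if x > 0 then F x else 0) = F"
    using F(2) by (auto simp: odd_ext_def fun_eq_iff not_less order.order_iff_strict)
qed

lemma integral_even_half_line:
  fixes f :: "real \<Rightarrow> real"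
  assumes f: "integrable lborel f" and even: "\<And>x. f (- x) = f x"
  shows "(\<integral>x. indicator {0..} x * f x \<partial>lborel) = (\<integral>x. f x \<partial>lborel) / 2"
proof -
  let ?g = "\<lambda>x. indicator {0..} x * f x"
  have g: "integrable lborel ?g"
    using integrable_mult_indicator[OF _ f, of "{0..}"] by simp
  have "(\<integral>x. f x \<partial>lborel) = (\<integral>x. ?g x + ?g (- x) \<partial>lborel)"
  proof (rule integral_cong_AE)
    show "AE x in lborel. f x = ?g x + ?g (- x)"
      using AE_lborel_singleton[of 0] by eventually_elim (auto simp: even split: split_indicator)
    have [measurable]: "f \<in> borel_measurable borel" using f by auto
    show "(\<lambda>x. ?g x + ?g (- x)) \<in> borel_measurable lborel" by measurable
  qed (use f in auto)
  also have "\<dots> = 2 * (\<integral>x. ?g x \<partial>lborel)"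
    using integral_reflect_real[of ?g] integrable_reflect_real[OF g] g by simp
  finally show ?thesis by simp
qed

section \<open>Kernels built from exp (- w * cosh t)\<close>

lemma cosh_measurable [measurable]: "(cosh :: real \<Rightarrow> real) \<in> borel_measurable borel"
  by (intro borel_measurable_continuous_onI continuous_intros)

lemma cosh_ge_quadratic: "(1 + x\<^sup>2) / 4 \<le> cosh (x :: real)"
proof -
  have "(1 + x\<^sup>2) / 4 \<le> exp \<bar>x\<bar> / 2"
    using exp_lower_Taylor_quadratic[of "\<bar>x\<bar>"] by simp
  also have "\<dots> \<le> cosh x"
    by (cases "x \<ge> 0") (auto simp: cosh_field_def)
  finally show ?thesis .
qed

lemma exp_cosh_integrable:
  fixes w :: real
  assumes w: "w > 0"
  shows "integrable lborel (\<lambda>t. exp (- w * cosh t))"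
proof (rule Bochner_Integration.integrable_bound)
  have "integrable lborel (\<lambda>x::real. inverse (1 + x\<^sup>2))"
    using integrable_inverse_1_plus_square by (simp add: set_integrable_def)
  then show "integrable lborel (\<lambda>x::real. 4 / w * inverse (1 + x\<^sup>2))" by simp
  show "AE t in lborel. norm (exp (- w * cosh t)) \<le> norm (4 / w * inverse (1 + t\<^sup>2))"
  proof (rule AE_I2)
    fix t :: real
    have p: "0 < w * ((1 + t\<^sup>2) / 4)" using w by (intro mult_pos_pos) (auto simp: add_pos_nonneg)
    have "w * ((1 + t\<^sup>2) / 4) \<le> w * cosh t" using cosh_ge_quadratic[of t] w by (intro mult_left_mono) auto
    also have "\<dots> \<le> exp (w * cosh t)" using exp_ge_add_one_self[of "w * cosh t"] by linarith
    finally have "inverse (exp (w * cosh t)) \<le> inverse (w * ((1 + t\<^sup>2) / 4))"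
      using p by (rule le_imp_inverse_le)
    then show "norm (exp (- w * cosh t)) \<le> norm (4 / w * inverse (1 + t\<^sup>2))"
      using w by (simp add: exp_minus field_simps)
  qed
qed measurable

lemma K0_eq: "K0 w = (\<integral>t. indicator {0..} t * exp (- w * cosh t) \<partial>lborel)"
  unfolding K0_def set_lebesgue_integral_def by (subst integral_completion) auto

lemma K0_measurable [measurable]: "K0 \<in> borel_measurable borel"
  unfolding K0_eq [abs_def] by measurable

lemma K0_nonneg: "0 \<le> K0 w"
  unfolding K0_eq by simp

lemma exp_cosh_integral:
  assumes "w > 0"
  shows "(\<integral>t. exp (- w * cosh t) \<partial>lborel) = 2 * K0 w"
  unfolding K0_eq using integral_even_half_line[OF exp_cosh_integrable[OF assms]] by simp

lemma K0_antimono: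
  assumes "0 < w" "w \<le> w'"
  shows "K0 w' \<le> K0 w"
proof -
  have "(\<integral>t. exp (- w' * cosh t) \<partial>lborel) \<le> (\<integral>t. exp (- w * cosh t) \<partial>lborel)"
    using assms by (intro integral_mono exp_cosh_integrable) (auto intro!: mult_right_mono)
  moreover have "0 < w'" using assms by simp
  ultimately show ?thesis unfolding exp_cosh_integral[OF assms(1)] exp_cosh_integral[OF \<open>0 < w'\<close>] by simp
qed

text \<open>
  This is twice the Macdonald function of imaginary order \<open>\<i> * y\<close> at \<open>w\<close>.
\<close>

definition bessel_hat :: "real \<Rightarrow> real \<Rightarrow> complex" where
  "bessel_hat w y = FT (\<lambda>t. of_real (exp (- w * cosh t))) y"

lemma bessel_hat_measurable [measurable]: "(\<lambda>w. bessel_hat w y) \<in> borel_measurable borel"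
  unfolding bessel_hat_def FT_def by measurable

lemma norm_bessel_hat_le: "w > 0 \<Longrightarrow> norm (bessel_hat w y) \<le> 2 * K0 w"
  unfolding bessel_hat_def using norm_FT_le[of "\<lambda>t. of_real (exp (- w * cosh t))" y] exp_cosh_integral[of w]
  by simp

text \<open>
  Both kernels of the convolutions with the Macdonald weight are signed sums of functions
  \<open>exp (- w * cosh (x - \<kappa>))\<close> with \<open>\<kappa>\<close> a signed sum of the other integration variables. The variable
  \<open>z\<close> stands for the tuple of all integration variables, \<open>\<omega> z\<close> for the component that plays the role of
  \<open>w\<close>, and \<open>Q z\<close> for the product of the given functions.
\<close>

definition cosh_potential :: "('z::euclidean_space \<Rightarrow> real) \<Rightarrow> ('z \<Rightarrow> real) \<Rightarrow> ('z \<Rightarrow> complex) \<Rightarrow> real \<Rightarrow> complex" where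
  "cosh_potential \<kappa> \<omega> Q x = (\<integral>z. of_real (exp (- \<omega> z * cosh (x - \<kappa> z))) * Q z \<partial>lborel)"

text \<open>
  In the variable \<open>x\<close> the kernel is a translate by \<open>\<kappa> z\<close> of a function of integral \<open>2 * K0 (\<omega> z)\<close>, so
  the weight \<open>K0\<close> is exactly what makes the joint integral converge. Exchanging the order of integration
  gives the transform: translation contributes the factor \<open>cis (- (\<kappa> z * y))\<close>.
\<close>

lemma
  fixes \<kappa> \<omega> :: "'z::euclidean_space \<Rightarrow> real" and Q :: "'z \<Rightarrow> complex"
  assumes [measurable]: "\<kappa> \<in> borel_measurable borel" "\<omega> \<in> borel_measurable borel" "Q \<in> borel_measurable borel"
    and "\<forall>z. Q z \<noteq> 0 \<longrightarrow> \<omega> z > 0"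
    and int: "integrable lborel (\<lambda>z. norm (Q z) * K0 (\<omega> z))"
  shows integrable_cosh_potential: "integrable lborel (cosh_potential \<kappa> \<omega> Q)"
    and AE_integrable_cosh_potential:
      "AE x in lborel. integrable lborel (\<lambda>z. of_real (exp (- \<omega> z * cosh (x - \<kappa> z))) * Q z)"
    and cosh_potential_norm_le:
      "(\<integral>x. norm (cosh_potential \<kappa> \<omega> Q x) \<partial>lborel) \<le> 2 * (\<integral>z. norm (Q z) * K0 (\<omega> z) \<partial>lborel)"
    and FT_cosh_potential:
      "FT (cosh_potential \<kappa> \<omega> Q) y = (\<integral>z. Q z * cis (- (\<kappa> z * y)) * bessel_hat (\<omega> z) y \<partial>lborel)"
proof -
  have pos: "\<omega> z > 0" if "Q z \<noteq> 0" for z using assms(4) that by simp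
  let ?F = "\<lambda>z x. of_real (exp (- \<omega> z * cosh (x - \<kappa> z))) * Q z"
  have norm_F: "(\<integral>x. norm (?F z x) \<partial>lborel) = 2 * (norm (Q z) * K0 (\<omega> z))" for z
  proof (cases "Q z = 0")
    case False
    then show ?thesis
      using integral_shift[of "\<lambda>x. exp (- \<omega> z * cosh x)" "\<kappa> z"] exp_cosh_integral[OF pos]
      by (simp add: norm_mult)
  qed simp
  have I: "integrable (lborel \<Otimes>\<^sub>M lborel) (case_prod ?F)"
  proof (rule lborel_pair.Fubini_integrable)
    show "integrable lborel (\<lambda>z. \<integral>x. norm (case (z, x) of (z, x) \<Rightarrow> ?F z x) \<partial>lborel)"
      unfolding prod.case norm_F using int by simp
    show "AE z in lborel. integrable lborel (\<lambda>x. case (z, x) of (z, x) \<Rightarrow> ?F z x)"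
    proof (rule AE_I2)
      fix z
      show "integrable lborel (\<lambda>x. case (z, x) of (z, x) \<Rightarrow> ?F z x)"
      proof (cases "Q z = 0")
        case False
        from integrable_shift[OF exp_cosh_integrable[OF pos[OF this]], of "\<kappa> z"]
        show ?thesis unfolding prod.case by (intro integrable_mult_left integrable_of_real)
      qed simp
    qed
  qed measurable
  show "integrable lborel (cosh_potential \<kappa> \<omega> Q)"
    using lborel_pair.integrable_snd[OF I] unfolding cosh_potential_def [abs_def] .
  show "AE x in lborel. integrable lborel (\<lambda>z. ?F z x)"
    using lborel_pair.AE_integrable_snd[OF I] .
  show "(\<integral>x. norm (cosh_potential \<kappa> \<omega> Q x) \<partial>lborel) \<le> 2 * (\<integral>z. norm (Q z) * K0 (\<omega> z) \<partial>lborel)"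
    using integral_norm_integral_le[OF _ I] unfolding norm_F
    by (simp add: cosh_potential_def lborel.sigma_finite_measure_axioms)
  have I2: "integrable (lborel \<Otimes>\<^sub>M lborel) (\<lambda>(z, x). ?F z x * cis (- (x * y)))"
    using integrable_mult_unimodular[OF I, of "\<lambda>(z, x). cis (- (x * y))"]
    by (simp add: case_prod_unfold)
  have "FT (cosh_potential \<kappa> \<omega> Q) y = (\<integral>x. (\<integral>z. ?F z x * cis (- (x * y)) \<partial>lborel) \<partial>lborel)"
    unfolding FT_def cosh_potential_def by simp
  also have "\<dots> = (\<integral>z. (\<integral>x. ?F z x * cis (- (x * y)) \<partial>lborel) \<partial>lborel)"
    by (rule lborel_pair.Fubini_integral[OF I2])
  also have "\<dots> = (\<integral>z. Q z * cis (- (\<kappa> z * y)) * bessel_hat (\<omega> z) y \<partial>lborel)"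
  proof (intro Bochner_Integration.integral_cong refl)
    fix z
    let ?e = "\<lambda>x. of_real (exp (- \<omega> z * cosh x)) * cis (- (x * y))"
    have "(\<integral>x. ?F z x * cis (- (x * y)) \<partial>lborel) =
          (\<integral>x. Q z * cis (- (\<kappa> z * y)) * ?e (x - \<kappa> z) \<partial>lborel)"
    proof (intro Bochner_Integration.integral_cong refl)
      fix x :: real
      have "cis (- (x * y)) = cis (- (\<kappa> z * y)) * cis (- ((x - \<kappa> z) * y))"
        by (simp add: cis_mult algebra_simps)
      then show "?F z x * cis (- (x * y)) = Q z * cis (- (\<kappa> z * y)) * ?e (x - \<kappa> z)" by simp
    qed
    also have "\<dots> = Q z * cis (- (\<kappa> z * y)) * bessel_hat (\<omega> z) y"
      by (simp only: integral_mult_right_zero integral_shift[of ?e] bessel_hat_def FT_def)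
    finally show "(\<integral>x. ?F z x * cis (- (x * y)) \<partial>lborel) = Q z * cis (- (\<kappa> z * y)) * bessel_hat (\<omega> z) y" .
  qed
  finally show "FT (cosh_potential \<kappa> \<omega> Q) y = (\<integral>z. Q z * cis (- (\<kappa> z * y)) * bessel_hat (\<omega> z) y \<partial>lborel)" .
qed

lemma
  fixes f :: "'a::euclidean_space \<Rightarrow> 'c::{real_normed_field, banach, second_countable_topology}"
    and g :: "'b::euclidean_space \<Rightarrow> 'c"
  assumes f: "integrable lborel f" and g: "integrable lborel g"
  shows integrable_tensor: "integrable lborel (\<lambda>(x, y). f x * g y)"
    and integral_tensor: "(\<integral>(x, y). f x * g y \<partial>lborel) = (\<integral>x. f x \<partial>lborel) * (\<integral>y. g y \<partial>lborel)"
proof -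
  have [measurable]: "f \<in> borel_measurable borel" "g \<in> borel_measurable borel" using f g by auto
  have I: "integrable (lborel \<Otimes>\<^sub>M lborel) (\<lambda>(x, y). f x * g y)"
  proof (rule lborel_pair.Fubini_integrable)
    show "(\<lambda>(x, y). f x * g y) \<in> borel_measurable (lborel \<Otimes>\<^sub>M lborel)" by measurable
  qed (use f g in \<open>auto simp: norm_mult\<close>)
  then show "integrable lborel (\<lambda>(x, y). f x * g y)" by (simp add: lborel_prod)
  show "(\<integral>(x, y). f x * g y \<partial>lborel) = (\<integral>x. f x \<partial>lborel) * (\<integral>y. g y \<partial>lborel)"
    using lborel_pair.integral_fst[OF I] by (simp add: lborel_prod)
qed

lemma
  assumes ae: "AE x in lborel. P x"
  shows AE_lborel_fst: "AE z in (lborel :: ('a::euclidean_space \<times> 'b::euclidean_space) measure). P (fst z)"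
    and AE_lborel_snd: "AE z in (lborel :: ('b::euclidean_space \<times> 'a::euclidean_space) measure). P (snd z)"
proof -
  obtain N where N: "N \<in> null_sets (lborel :: 'a measure)" "{x. \<not> P x} \<subseteq> N"
    using ae unfolding eventually_ae_filter by auto
  have N': "N \<in> sets borel" "emeasure lborel N = 0" using N(1) by auto
  have "N \<times> (UNIV :: 'b set) \<in> null_sets (lborel \<Otimes>\<^sub>M lborel)"
    using N' by (intro null_setsI) (auto simp: lborel.emeasure_pair_measure_Times)
  then show "AE z in (lborel :: ('a \<times> 'b) measure). P (fst z)"
    unfolding lborel_prod by (rule AE_I') (use N(2) in auto)
  have "(UNIV :: 'b set) \<times> N \<in> null_sets (lborel \<Otimes>\<^sub>M lborel)"
    using N' by (intro null_setsI) (auto simp: lborel.emeasure_pair_measure_Times)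
  then show "AE z in (lborel :: ('b \<times> 'a) measure). P (snd z)"
    unfolding lborel_prod by (rule AE_I') (use N(2) in auto)
qed

text \<open>
  The weight here is that of \<open>\<beta> = 1\<close>, the smallest one for \<open>0 < \<beta> \<le> 1\<close> since \<open>K0\<close> decreases.
\<close>

definition weighted_rep :: "(real \<Rightarrow> complex) \<Rightarrow> (real \<Rightarrow> complex) \<Rightarrow> bool" where
  "weighted_rep h H \<longleftrightarrow> H \<in> borel_measurable borel \<and> (\<forall>w\<le>0. H w = 0) \<and>
     (AE w in lborel. w > 0 \<longrightarrow> h w = H w) \<and> integrable lborel (\<lambda>w. norm (H w) * K0 w)"

lemma L1_weighted_rep:
  assumes \<beta>: "0 < \<beta>" "\<beta> \<le> 1" and h: "h \<in> L1_weighted \<beta>"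
  obtains H where "weighted_rep h H" "(\<integral>w. norm (H w) * K0 w \<partial>lborel) \<le> L1_weighted_norm \<beta> h"
proof -
  have "set_borel_measurable lebesgue {0..} h" using h by (simp add: L1_weighted_def)
  then obtain H where H: "H \<in> borel_measurable borel" "\<And>x. x \<le> 0 \<Longrightarrow> H x = 0" "AE x in lborel. x > 0 \<longrightarrow> h x = H x"
    using half_line_borel_version[of h] by metis
  note [measurable] = H(1)
  let ?k = "\<lambda>w. norm (H w) * K0 (\<beta> * w)" and ?i = "\<lambda>w. indicator {0..} w *\<^sub>R (norm (h w) * K0 (\<beta> * w))"
  have "AE w in lborel. indicator {0..} w *\<^sub>R of_real (norm (h w) * K0 (\<beta> * w)) = (of_real (?k w) :: complex)"
    by (rule half_line_AE_eq) (use H(2,3) in \<open>auto elim: eventually_mono\<close>)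
  then have AE: "AE w in lborel. of_real (?i w) = (of_real (?k w) :: complex)"
    by eventually_elim (auto split: split_indicator)
  have "integrable lebesgue ?i"
    using h by (simp add: L1_weighted_def set_integrable_def)
  then have "integrable lebesgue (\<lambda>w. of_real (?i w) :: complex)"
    by (rule integrable_of_real)
  then have "integrable lborel (\<lambda>w. of_real (?k w) :: complex)"
    by (subst (asm) integrable_lebesgue_iff_lborel[OF _ AE]) measurable
  then have k: "integrable lborel ?k" by (simp only: complex_of_real_integrable_eq)
  have "(\<integral>w. (of_real (?i w) :: complex) \<partial>lebesgue) = (\<integral>w. of_real (?k w) \<partial>lborel)"
    by (rule integral_lebesgue_eq_lborel[OF _ AE]) measurable
  then have norm: "L1_weighted_norm \<beta> h = (\<integral>w. ?k w \<partial>lborel)"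
    by (simp only: integral_complex_of_real of_real_eq_iff L1_weighted_norm_def set_lebesgue_integral_def)
  have le: "norm (H w) * K0 w \<le> ?k w" for w
  proof (cases "w > 0")
    case True
    then show ?thesis using \<beta> by (intro mult_left_mono K0_antimono) (auto simp: mult_left_le_one_le)
  qed (simp add: H(2))
  have i: "integrable lborel (\<lambda>w. norm (H w) * K0 w)"
    by (rule Bochner_Integration.integrable_bound[OF k]) (use le K0_nonneg in \<open>auto simp: abs_mult\<close>)
  show ?thesis
  proof (rule that)
    show "weighted_rep h H" using H i by (auto simp: weighted_rep_def)
    show "(\<integral>w. norm (H w) * K0 w \<partial>lborel) \<le> L1_weighted_norm \<beta> h"
      unfolding norm by (rule integral_mono[OF i k le])
  qed
qed

definition macdonald_transform :: "(real \<Rightarrow> complex) \<Rightarrow> real \<Rightarrow> complex" where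
  "macdonald_transform H y = (\<integral>w. H w * bessel_hat w y \<partial>lborel)"

lemma integrable_macdonald:
  assumes "weighted_rep h H"
  shows "integrable lborel (\<lambda>w. H w * bessel_hat w y)"
proof (rule Bochner_Integration.integrable_bound)
  have [measurable]: "H \<in> borel_measurable borel" using assms by (simp add: weighted_rep_def)
  show "integrable lborel (\<lambda>w. 2 * (norm (H w) * K0 w))" using assms by (auto simp: weighted_rep_def)
  show "AE w in lborel. norm (H w * bessel_hat w y) \<le> norm (2 * (norm (H w) * K0 w))"
  proof (rule AE_I2)
    fix w
    show "norm (H w * bessel_hat w y) \<le> norm (2 * (norm (H w) * K0 w))"
    proof (cases "w > 0")
      case True
      from mult_left_mono[OF norm_bessel_hat_le[OF this], of "norm (H w)" y] show ?thesis
        by (simp add: norm_mult K0_nonneg)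
    qed (use assms in \<open>simp add: weighted_rep_def\<close>)
  qed
  show "(\<lambda>w. H w * bessel_hat w y) \<in> borel_measurable lborel" by measurable
qed

lemma measurable_fst_borel [measurable]:
  "fst \<in> borel_measurable (borel :: ('a::second_countable_topology \<times> 'b::second_countable_topology) measure)"
  by (intro borel_measurable_continuous_onI continuous_intros)

lemma measurable_snd_borel [measurable]:
  "snd \<in> borel_measurable (borel :: ('a::second_countable_topology \<times> 'b::second_countable_topology) measure)"
  by (intro borel_measurable_continuous_onI continuous_intros)

lemma weighted_rep_AE:
  assumes "weighted_rep h H"
  shows "AE w in lborel. indicator {0..} w *\<^sub>R h w = H w"
  by (rule half_line_AE_eq) (use assms in \<open>auto simp: weighted_rep_def\<close>)

lemma half_line_rep_AE:
  assumes "half_line_rep f a"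
  shows "AE w in lborel. indicator {0..} w *\<^sub>R f w = a w"
  by (rule half_line_AE_eq) (use assms in \<open>auto simp: half_line_rep_def\<close>)

text \<open>
  The kernel is the difference of the potentials with \<open>\<kappa> = v\<close> and \<open>\<kappa> = - v\<close>. Their transforms are
  \<open>FT a y\<close> and \<open>FT a (- y)\<close> times the transform of \<open>H\<close>, and the difference of these is the transform of
  the odd extension.
\<close>

lemma
  assumes f: "half_line_rep f a" and h: "weighted_rep h H"
  shows integrable_yb_conv: "integrable lborel (yb_conv f h)"
    and FT_yb_conv: "FT (yb_conv f h) y = 1 / 2 * (FT (odd_ext a) y * macdonald_transform H y)"
proof -
  have a: "integrable lborel a" using f by (simp add: half_line_rep_def)
  have H: "H \<in> borel_measurable borel" "\<And>w. w \<le> 0 \<Longrightarrow> H w = 0" "integrable lborel (\<lambda>w. norm (H w) * K0 w)"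
    using h by (auto simp: weighted_rep_def)
  have [measurable]: "a \<in> borel_measurable borel" "H \<in> borel_measurable borel" using a H by auto
  define Q :: "real \<times> real \<Rightarrow> complex" where "Q z = H (fst z) * a (snd z)" for z
  define \<kappa> :: "real \<Rightarrow> real \<times> real \<Rightarrow> real" where "\<kappa> s z = s * snd z" for s z
  have m [measurable]: "Q \<in> borel_measurable borel" "\<kappa> s \<in> borel_measurable borel" for s
    unfolding Q_def [abs_def] \<kappa>_def [abs_def] by measurable
  have pos: "\<forall>z. Q z \<noteq> 0 \<longrightarrow> fst z > 0"
    using H(2) by (force simp: Q_def not_le[symmetric])
  have int: "integrable lborel (\<lambda>z. norm (Q z) * K0 (fst z))"
    using integrable_tensor[OF H(3) integrable_norm[OF a]]
    by (simp add: Q_def norm_mult case_prod_unfold mult_ac)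
  note pot = integrable_cosh_potential[OF m(2) measurable_fst_borel m(1) pos int]
    AE_integrable_cosh_potential[OF m(2) measurable_fst_borel m(1) pos int]
    FT_cosh_potential[OF m(2) measurable_fst_borel m(1) pos int]
  let ?P = "\<lambda>s. cosh_potential (\<kappa> s) fst Q"
  have FT_P: "FT (?P s) y = macdonald_transform H y * FT a (s * y)" for s
  proof -
    have "FT (?P s) y = (\<integral>(w, v). (H w * bessel_hat w y) * (a v * cis (- (v * (s * y)))) \<partial>lborel)"
      unfolding pot(3) by (intro Bochner_Integration.integral_cong) (auto simp: Q_def \<kappa>_def mult_ac)
    also have "\<dots> = macdonald_transform H y * FT a (s * y)"
      unfolding macdonald_transform_def FT_def
      by (rule integral_tensor[OF integrable_macdonald[OF h] integrable_FT[OF a]])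
    finally show ?thesis .
  qed
  have eq: "yb_conv f h x = 1 / 2 * (\<integral>z. of_real (exp (- fst z * cosh (snd z - x)) - exp (- fst z * cosh (snd z + x))) * Q z \<partial>lborel)" for x
    unfolding yb_conv_def set_lebesgue_integral_def
  proof (subst integral_lebesgue_eq_lborel)
    show "AE z in lborel. indicator ({0..} \<times> {0..}) z *\<^sub>R
        (case z of (u, v) \<Rightarrow> of_real (exp (- u * cosh (v - x)) - exp (- u * cosh (v + x))) * f v * h u) =
        of_real (exp (- fst z * cosh (snd z - x)) - exp (- fst z * cosh (snd z + x))) * Q z"
      using AE_lborel_fst[OF weighted_rep_AE[OF h]] AE_lborel_snd[OF half_line_rep_AE[OF f]]
    proof eventually_elim
      case (elim z)
      then show ?case by (cases z) (auto simp: Q_def split: split_indicator)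
    qed
  qed auto
  have AE: "AE x in lborel. yb_conv f h x = 1 / 2 * (?P 1 x - ?P (-1) x)"
    using pot(2)[of 1] pot(2)[of "-1"]
  proof eventually_elim
    case (elim x)
    have c: "cosh (v - x) = cosh (x - v)" "cosh (v + x) = cosh (x - (- v))" for v :: real
      using cosh_minus[of "x - v"] by (simp_all add: add.commute)
    have "?P 1 x - ?P (-1) x = (\<integral>z. of_real (exp (- fst z * cosh (x - \<kappa> 1 z))) * Q z - of_real (exp (- fst z * cosh (x - \<kappa> (-1) z))) * Q z \<partial>lborel)"
      unfolding cosh_potential_def by (rule Bochner_Integration.integral_diff[OF elim, symmetric])
    also have "\<dots> = (\<integral>z. of_real (exp (- fst z * cosh (snd z - x)) - exp (- fst z * cosh (snd z + x))) * Q z \<partial>lborel)"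
      unfolding c by (intro Bochner_Integration.integral_cong) (auto simp: \<kappa>_def ring_distribs)
    finally show ?case by (simp add: eq)
  qed
  have meas: "yb_conv f h \<in> borel_measurable borel"
    unfolding eq [abs_def] by measurable
  have I: "integrable lborel (\<lambda>x. 1 / 2 * (?P 1 x - ?P (-1) x))"
    by (intro integrable_mult_right Bochner_Integration.integrable_diff pot(1))
  show "integrable lborel (yb_conv f h)"
    using integrable_cong_AE[OF _ _ AE] I meas by auto
  have "FT (yb_conv f h) y = FT (\<lambda>x. 1 / 2 * (?P 1 x - ?P (-1) x)) y"
    by (rule FT_cong_AE[OF meas _ AE]) (use I in auto)
  also have "\<dots> = 1 / 2 * (FT (?P 1) y - FT (?P (-1)) y)"
    by (simp only: FT_cmult FT_diff[OF pot(1) pot(1)])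
  also have "\<dots> = 1 / 2 * (FT (odd_ext a) y * macdonald_transform H y)"
    unfolding FT_P FT_odd_ext[OF a] by (simp add: ring_distribs mult_ac)
  finally show "FT (yb_conv f h) y = 1 / 2 * (FT (odd_ext a) y * macdonald_transform H y)" .
qed

lemma Phi_odd: "Phi (- x) u v w = - Phi x u v w"
proof -
  have c: "cosh (- x - u + v) = cosh (x + u - v)" "cosh (- x - u - v) = cosh (x + u + v)"
       "cosh (- x + u + v) = cosh (x - u - v)" "cosh (- x + u - v) = cosh (x - u + v)"
    by (subst cosh_minus[symmetric], simp add: algebra_simps)+
  show ?thesis unfolding Phi_def c by simp
qed

lemma polyconv_odd: "polyconv f g h (- x) = - polyconv f g h x"
proof -
  have "(\<lambda>(u, v, w). of_real (Phi (- x) u v w) * f u * g v * h w) =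
      (\<lambda>z. - (case z of (u, v, w) \<Rightarrow> of_real (Phi x u v w) * f u * g v * h w))"
    by (auto simp: Phi_odd)
  then show ?thesis
    unfolding polyconv_def set_lebesgue_integral_def by simp
qed

text \<open>
  The four terms of \<open>Phi\<close> are the potentials with \<open>\<kappa> = s * u + t * v\<close> for signs \<open>s\<close> and \<open>t\<close>, taken with
  the sign \<open>s\<close>. The transform of each is \<open>FT a (s * y) * FT b (t * y)\<close> times the transform of \<open>H\<close>, and
  the signed sum factors into the transforms of the odd extension of \<open>a\<close> and the even extension of \<open>b\<close>.
  The norm bound on the whole line adds the four bounds \<open>2 * K0\<close>; by oddness half of it belongs to the
  half-line.
\<close>

lemma
  assumes f: "half_line_rep f a" and g: "half_line_rep g b" and h: "weighted_rep h H"
  shows integrable_polyconv: "integrable lborel (polyconv f g h)"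
    and FT_polyconv: "FT (polyconv f g h) y =
      of_real (1 / (2 * sqrt (2 * pi))) * (FT (odd_ext a) y * FT (even_ext b) y * macdonald_transform H y)"
    and polyconv_norm_le: "(\<integral>x. norm (polyconv f g h x) \<partial>lborel) \<le>
      2 * sqrt (2 / pi) * ((\<integral>x. norm (a x) \<partial>lborel) * ((\<integral>x. norm (b x) \<partial>lborel) * (\<integral>w. norm (H w) * K0 w \<partial>lborel)))"
proof -
  have a: "integrable lborel a" using f by (simp add: half_line_rep_def)
  have b: "integrable lborel b" using g by (simp add: half_line_rep_def)
  have H: "H \<in> borel_measurable borel" "\<And>w. w \<le> 0 \<Longrightarrow> H w = 0" "integrable lborel (\<lambda>w. norm (H w) * K0 w)"
    using h by (auto simp: weighted_rep_def)
  have [measurable]: "a \<in> borel_measurable borel" "b \<in> borel_measurable borel" "H \<in> borel_measurable borel"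
    using a b H by auto
  let ?C = "1 / (2 * sqrt (2 * pi))"
  define Q :: "real \<times> real \<times> real \<Rightarrow> complex" where "Q z = a (fst z) * (b (fst (snd z)) * H (snd (snd z)))" for z
  define \<omega> :: "real \<times> real \<times> real \<Rightarrow> real" where "\<omega> z = snd (snd z)" for z
  define \<kappa> :: "real \<Rightarrow> real \<Rightarrow> real \<times> real \<times> real \<Rightarrow> real" where "\<kappa> s t z = s * fst z + t * fst (snd z)" for s t z
  have m [measurable]: "Q \<in> borel_measurable borel" "\<omega> \<in> borel_measurable borel" "\<kappa> s t \<in> borel_measurable borel" for s t
    unfolding Q_def [abs_def] \<omega>_def [abs_def] \<kappa>_def [abs_def] by measurable
  have pos: "\<forall>z. Q z \<noteq> 0 \<longrightarrow> \<omega> z > 0"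
    using H(2) by (force simp: Q_def \<omega>_def not_le[symmetric])
  note tensor = integrable_tensor[OF integrable_norm[OF a] integrable_tensor[OF integrable_norm[OF b] H(3)]]
  have Qeq: "(\<lambda>z. norm (Q z) * K0 (\<omega> z)) = (\<lambda>(u, p). norm (a u) * (case p of (v, w) \<Rightarrow> norm (b v) * (norm (H w) * K0 w)))"
    by (auto simp: Q_def \<omega>_def norm_mult mult_ac)
  have int: "integrable lborel (\<lambda>z. norm (Q z) * K0 (\<omega> z))"
    unfolding Qeq by (rule tensor)
  have Qnorm: "(\<integral>z. norm (Q z) * K0 (\<omega> z) \<partial>lborel) =
      (\<integral>x. norm (a x) \<partial>lborel) * ((\<integral>x. norm (b x) \<partial>lborel) * (\<integral>w. norm (H w) * K0 w \<partial>lborel))"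
    unfolding Qeq
    by (simp only: integral_tensor[OF integrable_norm[OF a] integrable_tensor[OF integrable_norm[OF b] H(3)]]
        integral_tensor[OF integrable_norm[OF b] H(3)])
  note pot = integrable_cosh_potential[OF m(3,2,1) pos int]
    AE_integrable_cosh_potential[OF m(3,2,1) pos int]
    FT_cosh_potential[OF m(3,2,1) pos int]
    cosh_potential_norm_le[OF m(3,2,1) pos int]
  let ?P = "\<lambda>s t. cosh_potential (\<kappa> s t) \<omega> Q"
  have FT_P: "FT (?P s t) y = FT a (s * y) * (FT b (t * y) * macdonald_transform H y)" for s t
  proof -
    have "FT (?P s t) y = (\<integral>(u, p). (a u * cis (- (u * (s * y)))) *
        (case p of (v, w) \<Rightarrow> (b v * cis (- (v * (t * y)))) * (H w * bessel_hat w y)) \<partial>lborel)"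
      unfolding pot(3)
    proof (intro Bochner_Integration.integral_cong refl)
      fix z :: "real \<times> real \<times> real"
      obtain u v w where z: "z = (u, v, w)" by (cases z)
      have "cis (- (\<kappa> s t z * y)) = cis (- (u * (s * y))) * cis (- (v * (t * y)))"
        by (simp add: cis_mult \<kappa>_def z algebra_simps)
      then show "Q z * cis (- (\<kappa> s t z * y)) * bessel_hat (\<omega> z) y =
          (case z of (u, p) \<Rightarrow> (a u * cis (- (u * (s * y)))) *
          (case p of (v, w) \<Rightarrow> (b v * cis (- (v * (t * y)))) * (H w * bessel_hat w y)))"
        by (simp add: z Q_def \<omega>_def mult_ac)
    qed
    also have "\<dots> = FT a (s * y) * (FT b (t * y) * macdonald_transform H y)"
      unfolding macdonald_transform_def FT_def
      by (simp only: integral_tensor[OF integrable_FT[OF a] integrable_tensor[OF integrable_FT[OF b] integrable_macdonald[OF h]]]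
          integral_tensor[OF integrable_FT[OF b] integrable_macdonald[OF h]])
    finally show ?thesis .
  qed
  have eq: "polyconv f g h x = of_real ?C * (\<integral>z. of_real (Phi x (fst z) (fst (snd z)) (snd (snd z))) * Q z \<partial>lborel)" for x
    unfolding polyconv_def set_lebesgue_integral_def
  proof (subst integral_lebesgue_eq_lborel)
    show "AE z in lborel. indicator ({0..} \<times> {0..} \<times> {0..}) z *\<^sub>R
        (case z of (u, v, w) \<Rightarrow> of_real (Phi x u v w) * f u * g v * h w) =
        of_real (Phi x (fst z) (fst (snd z)) (snd (snd z))) * Q z"
      using AE_lborel_fst[OF half_line_rep_AE[OF f]] AE_lborel_snd[OF AE_lborel_fst[OF half_line_rep_AE[OF g]]]
        AE_lborel_snd[OF AE_lborel_snd[OF weighted_rep_AE[OF h]]]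
    proof eventually_elim
      case (elim z)
      then show ?case by (cases z) (auto simp: Q_def split: split_indicator)
    qed
  qed (auto simp: Phi_def)
  let ?R = "\<lambda>x. of_real ?C * (?P 1 (-1) x + ?P 1 1 x - ?P (-1) (-1) x - ?P (-1) 1 x)"
  have AE: "AE x in lborel. polyconv f g h x = ?R x"
    using pot(2)[of 1 "-1"] pot(2)[of 1 1] pot(2)[of "-1" "-1"] pot(2)[of "-1" 1]
  proof eventually_elim
    case (elim x)
    let ?e = "\<lambda>s t z. of_real (exp (- \<omega> z * cosh (x - \<kappa> s t z))) * Q z"
    have "?P 1 (-1) x + ?P 1 1 x - ?P (-1) (-1) x - ?P (-1) 1 x =
        (\<integral>z. ?e 1 (-1) z + ?e 1 1 z - ?e (-1) (-1) z - ?e (-1) 1 z \<partial>lborel)"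
      unfolding cosh_potential_def using elim by simp
    also have "\<dots> = (\<integral>z. of_real (Phi x (fst z) (fst (snd z)) (snd (snd z))) * Q z \<partial>lborel)"
      by (intro Bochner_Integration.integral_cong) (auto simp: \<kappa>_def \<omega>_def Phi_def algebra_simps)
    finally show ?case by (simp only: eq)
  qed
  have meas: "polyconv f g h \<in> borel_measurable borel"
    unfolding eq [abs_def] Phi_def by measurable
  have I: "integrable lborel ?R"
    by (intro integrable_mult_right Bochner_Integration.integrable_diff Bochner_Integration.integrable_add pot(1))
  show "integrable lborel (polyconv f g h)"
    using integrable_cong_AE[OF _ _ AE] I meas by auto
  have "FT (polyconv f g h) y = FT ?R y"
    by (rule FT_cong_AE[OF meas _ AE]) (use I in auto)
  also have "\<dots> = of_real ?C * (FT (?P 1 (-1)) y + FT (?P 1 1) y - FT (?P (-1) (-1)) y - FT (?P (-1) 1) y)"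
    unfolding FT_cmult by (simp add: FT_diff FT_add pot(1))
  also have "\<dots> = of_real ?C * (FT (odd_ext a) y * FT (even_ext b) y * macdonald_transform H y)"
    unfolding FT_P FT_odd_ext[OF a] FT_even_ext[OF b] by (simp add: algebra_simps)
  finally show "FT (polyconv f g h) y =
      of_real ?C * (FT (odd_ext a) y * FT (even_ext b) y * macdonald_transform H y)" .
  have C: "?C * 8 = 2 * sqrt (2 / pi)"
    by (simp add: real_sqrt_divide real_sqrt_mult field_simps)
  have "(\<integral>x. norm (polyconv f g h x) \<partial>lborel) = (\<integral>x. norm (?R x) \<partial>lborel)"
    by (rule integral_cong_AE) (use meas I AE in \<open>auto elim: eventually_mono\<close>)
  also have "\<dots> \<le> (\<integral>x. ?C * (norm (?P 1 (-1) x) + norm (?P 1 1 x) + norm (?P (-1) (-1) x) + norm (?P (-1) 1 x)) \<partial>lborel)"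
  proof (rule integral_mono)
    show "integrable lborel (\<lambda>x. norm (?R x))" by (rule integrable_norm[OF I])
    show "integrable lborel (\<lambda>x. ?C * (norm (?P 1 (-1) x) + norm (?P 1 1 x) + norm (?P (-1) (-1) x) + norm (?P (-1) 1 x)))"
      by (intro integrable_mult_right Bochner_Integration.integrable_add integrable_norm pot(1))
    fix x
    have "norm (p + q - r - s) \<le> norm p + norm q + norm r + norm s" for p q r s :: complex
      by norm
    from mult_left_mono[OF this, of ?C] show "norm (?R x) \<le> ?C * (norm (?P 1 (-1) x) + norm (?P 1 1 x) + norm (?P (-1) (-1) x) + norm (?P (-1) 1 x))"
      unfolding norm_mult norm_of_real by simp
  qed
  also have "\<dots> = ?C * ((\<integral>x. norm (?P 1 (-1) x) \<partial>lborel) + (\<integral>x. norm (?P 1 1 x) \<partial>lborel)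
      + (\<integral>x. norm (?P (-1) (-1) x) \<partial>lborel) + (\<integral>x. norm (?P (-1) 1 x) \<partial>lborel))"
    using pot(1) by simp
  also have "\<dots> \<le> ?C * (8 * (\<integral>z. norm (Q z) * K0 (\<omega> z) \<partial>lborel))"
    using pot(4)[of 1 "-1"] pot(4)[of 1 1] pot(4)[of "-1" "-1"] pot(4)[of "-1" 1]
    by (intro mult_left_mono) auto
  also have "\<dots> = 2 * sqrt (2 / pi) * (\<integral>z. norm (Q z) * K0 (\<omega> z) \<partial>lborel)"
    using C by (simp only: mult.assoc[symmetric])
  finally show "(\<integral>x. norm (polyconv f g h x) \<partial>lborel) \<le>
      2 * sqrt (2 / pi) * ((\<integral>x. norm (a x) \<partial>lborel) * ((\<integral>x. norm (b x) \<partial>lborel) * (\<integral>w. norm (H w) * K0 w \<partial>lborel)))"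
    unfolding Qnorm .
qed

section \<open>The integral equation\<close>

lemma FT_even_ext_even: "integrable lborel a \<Longrightarrow> FT (even_ext a) (- y) = FT (even_ext a) y"
  by (simp add: FT_even_ext)

text \<open>
  The cosine transform is the Fourier transform of the even extension up to the factor \<open>c\<close>. Wiener
  inversion on the line gives a function \<open>L\<close> that need not be even, but as its transform is even,
  its even part has the same transform, and \<open>l\<close> is the half-line function with this even extension.
  Evenness also extends the assumption from positive to negative frequencies.
\<close>

lemma wiener_inversion_fourier_cos:
  assumes b: "half_line_rep \<phi> b"
    and nz: "\<forall>y>0. 1 + fourier_cos \<phi> y \<noteq> 0" and nz0: "1 + fourier_cos \<phi> 0 \<noteq> 0"
  obtains l where "half_line_rep l l" "\<And>y. fourier_cos l y = fourier_cos \<phi> y / (1 + fourier_cos \<phi> y)"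
    "\<And>y. 1 + fourier_cos \<phi> y \<noteq> 0"
proof -
  define c :: complex where "c = of_real (1 / sqrt (2 * pi))"
  have c: "c \<noteq> 0" by (simp add: c_def)
  have bi: "integrable lborel b" using b by (simp add: half_line_rep_def)
  define k where "k x = c * even_ext b x" for x
  have k: "integrable lborel k"
    unfolding k_def [abs_def] by (intro integrable_mult_right integrable_even_ext bi)
  have FT_k: "FT k y = fourier_cos \<phi> y" for y
    unfolding k_def [abs_def] FT_cmult fourier_cos_eq_FT[OF b] c_def ..
  have even: "fourier_cos \<phi> (- y) = fourier_cos \<phi> y" for y
    by (simp add: fourier_cos_eq_FT[OF b] FT_even_ext_even[OF bi])
  have nz: "1 + fourier_cos \<phi> y \<noteq> 0" for y
    using nz nz0 even[of y] by (cases y "0 :: real" rule: linorder_cases) (metis neg_0_less_iff_less, auto)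
  obtain L where L: "integrable lborel L" "\<And>y. FT L y = fourier_cos \<phi> y / (1 + fourier_cos \<phi> y)"
    using wiener_inversion[OF k] nz unfolding FT_k by blast
  let ?E = "\<lambda>x. (L x + L (- x)) / (2 * c)"
  define l where "l x = (if x > 0 then ?E x else 0)" for x
  have E: "integrable lborel ?E" using L(1) by (simp add: integrable_reflect_real)
  have "integrable lborel (\<lambda>x. indicator {0<..} x *\<^sub>R ?E x)"
    using E by (intro integrable_mult_indicator) auto
  also have "(\<lambda>x. indicator {0<..} x *\<^sub>R ?E x) = l"
    by (auto simp: l_def fun_eq_iff split: split_indicator)
  finally have li: "integrable lborel l" .
  then have rep: "half_line_rep l l" by (auto simp: half_line_rep_def l_def)
  have "FT (even_ext l) y = FT L y / c" for y
  proof -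
    have "FT (even_ext l) y = FT (\<lambda>x. 1 / (2 * c) * (L x + L (- x))) y"
    proof (rule FT_cong_AE)
      show "AE x in lborel. even_ext l x = 1 / (2 * c) * (L x + L (- x))"
        using AE_lborel_singleton[of 0] by eventually_elim (auto simp: even_ext_def l_def add.commute)
    qed (use integrable_even_ext[OF li] E in auto)
    also have "\<dots> = 1 / (2 * c) * (FT L y + FT L (- y))"
      unfolding FT_cmult by (simp add: FT_add L(1) integrable_reflect_real FT_reflect)
    also have "\<dots> = FT L y / c" by (simp add: L(2) even)
    finally show ?thesis .
  qed
  then have inv: "fourier_cos l y = fourier_cos \<phi> y / (1 + fourier_cos \<phi> y)" for y
    using c by (simp only: fourier_cos_eq_FT[OF rep] c_def[symmetric] L(2)) simp
  show ?thesis by (rule that[OF rep inv nz])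
qed

text \<open>
  The cosine transform determines the transform of the even extension at all \<open>y \<noteq> 0\<close> by evenness,
  and at \<open>0\<close> by continuity.
\<close>

lemma fourier_cos_injective:
  assumes "m \<in> L1" "l \<in> L1" and eq: "\<forall>y>0. fourier_cos m y = fourier_cos l y"
  shows "AE x in lborel. x > 0 \<longrightarrow> m x = l x"
proof -
  obtain a b where a: "half_line_rep m a" and b: "half_line_rep l b"
    using assms L1_iff_half_line_rep by blast
  have ai: "integrable lborel a" and bi: "integrable lborel b" using a b by (auto simp: half_line_rep_def)
  note even_int = integrable_even_ext[OF ai] integrable_even_ext[OF bi]
  let ?D = "\<lambda>y. FT (even_ext a) y - FT (even_ext b) y"
  have pos: "?D y = 0" if "y > 0" for y
    using eq that by (simp add: fourier_cos_eq_FT[OF a] fourier_cos_eq_FT[OF b])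
  have "isCont ?D 0"
    using continuous_on_FT[OF even_int(1)] continuous_on_FT[OF even_int(2)]
    by (auto simp: continuous_on_eq_continuous_at intro!: continuous_intros)
  then have "(\<lambda>n. ?D (inverse (real (Suc n)))) \<longlonglongrightarrow> ?D 0"
    by (rule isCont_tendsto_compose[OF _ LIMSEQ_inverse_real_of_nat])
  moreover have "(\<lambda>n. ?D (inverse (real (Suc n)))) = (\<lambda>n. 0)"
    by (intro ext pos) simp
  ultimately have zero: "?D 0 = 0" by (simp add: LIMSEQ_const_iff)
  have "?D y = 0" for y
  proof (cases y "0 :: real" rule: linorder_cases)
    case less
    then show ?thesis using pos[of "- y"] by (simp add: FT_even_ext_even ai bi)
  qed (use zero pos in auto)
  then have "AE x in lborel. even_ext a x = even_ext b x"
    by (intro FT_unique even_int) auto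
  moreover have "AE x in lborel. x > 0 \<longrightarrow> m x = a x" "AE x in lborel. x > 0 \<longrightarrow> l x = b x"
    using a b by (auto simp: half_line_rep_def)
  ultimately show ?thesis
  proof eventually_elim
    case (elim x)
    have "a (- x) = 0 \<and> b (- x) = 0" if "x > 0" using that a b by (auto simp: half_line_rep_def)
    with elim show ?case by (auto simp: even_ext_def)
  qed
qed

text \<open>
  Let \<open>p\<close> be the right hand side of the equation, which is odd on the line. An integrable function
  solves the equation exactly if its odd extension \<open>G\<close> satisfies
  \<open>FT G y * (1 + fourier_cos \<phi> y) = FT p y\<close> for all \<open>y\<close>, because both sides of the equation extend
  to odd functions on the line.
\<close>

theorem theorem4p1:
  fixes \<beta> :: real and \<xi> \<phi> h :: "real \<Rightarrow> complex"
  assumes "0 < \<beta>" and "\<beta> \<le> 1"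
    and "\<xi> \<in> L1" and "\<phi> \<in> L1" and "h \<in> L1_weighted \<beta>"
    and "\<forall>y>0. 1 + fourier_cos \<phi> y \<noteq> 0"
    and at_zero: "1 + fourier_cos \<phi> 0 \<noteq> 0"
  shows "\<exists>f l. L1_solution \<xi> \<phi> h f
    \<and> (\<forall>g. L1_solution \<xi> \<phi> h g \<longrightarrow> (AE x in lebesgue. x > 0 \<longrightarrow> g x = f x))
    \<and> l \<in> L1
    \<and> (\<forall>y>0. fourier_cos l y = fourier_cos \<phi> y / (1 + fourier_cos \<phi> y))
    \<and> (\<forall>m\<in>L1. (\<forall>y>0. fourier_cos m y = fourier_cos \<phi> y / (1 + fourier_cos \<phi> y))
          \<longrightarrow> (AE x in lebesgue. x > 0 \<longrightarrow> m x = l x))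
    \<and> (AE x in lebesgue. x > 0 \<longrightarrow> f x = polyconv \<xi> l h x)
    \<and> (AE x in lebesgue. x > 0 \<longrightarrow> f x = yb_conv (sneddon_conv \<xi> l) h x)
    \<and> L1_norm f \<le> sqrt (2 / pi) * L1_norm \<xi> * L1_norm l * L1_weighted_norm \<beta> h"
proof -
  obtain a b where a: "half_line_rep \<xi> a" and b: "half_line_rep \<phi> b"
    using assms(3,4) L1_iff_half_line_rep by blast
  obtain H where H: "weighted_rep h H" "(\<integral>w. norm (H w) * K0 w \<partial>lborel) \<le> L1_weighted_norm \<beta> h"
    using L1_weighted_rep[OF assms(1,2,5)] by blast
  obtain l where l: "half_line_rep l l"
      "\<And>y. fourier_cos l y = fourier_cos \<phi> y / (1 + fourier_cos \<phi> y)"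
      "\<And>y. 1 + fourier_cos \<phi> y \<noteq> 0"
    using wiener_inversion_fourier_cos[OF b assms(6) at_zero] by metis
  have ai: "integrable lborel a" and bi: "integrable lborel b" and li: "integrable lborel l"
    using a b l(1) by (auto simp: half_line_rep_def)
  define c :: complex where "c = of_real (1 / sqrt (2 * pi))"
  have half_c: "of_real (1 / (2 * sqrt (2 * pi))) = c / 2"
    unfolding c_def of_real_divide of_real_mult by simp
  have cos_b: "fourier_cos \<phi> y = c * FT (even_ext b) y" and cos_l: "fourier_cos l y = c * FT (even_ext l) y" for y
    by (simp_all only: fourier_cos_eq_FT[OF b] fourier_cos_eq_FT[OF l(1)] c_def)
  define f where "f = polyconv \<xi> l h"
  define p where "p = polyconv \<xi> \<phi> h"
  have f: "integrable lborel f" "\<And>x. f (- x) = - f x" and p: "integrable lborel p" "\<And>x. p (- x) = - p x"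
    unfolding f_def p_def using integrable_polyconv[OF a l(1) H(1)] integrable_polyconv[OF a b H(1)]
    by (auto simp: polyconv_odd)
  have FT_f: "FT f y = c / 2 * (FT (odd_ext a) y * FT (even_ext l) y * macdonald_transform H y)" for y
    unfolding f_def FT_polyconv[OF a l(1) H(1)] half_c ..
  have FT_p: "FT p y = c / 2 * (FT (odd_ext a) y * FT (even_ext b) y * macdonald_transform H y)" for y
    unfolding p_def FT_polyconv[OF a b H(1)] half_c ..
  have c0: "c \<noteq> 0" by (simp add: c_def)
  have FT_l: "FT (even_ext l) y * (1 + fourier_cos \<phi> y) = FT (even_ext b) y" for y
  proof -
    have "c * (FT (even_ext l) y * (1 + fourier_cos \<phi> y)) = c * FT (even_ext b) y"
      using l(2,3)[of y] by (simp add: cos_l[symmetric] cos_b[symmetric] mult.assoc[symmetric])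
    with c0 show ?thesis by simp
  qed
  have FT_eq: "FT f y * (1 + fourier_cos \<phi> y) = FT p y" for y
    unfolding FT_f FT_p FT_l[symmetric] by simp
  \<comment> \<open>\<open>f\<close> is odd on the whole line by its defining formula, so it is its own odd extension.\<close>
  note rep_f = half_line_rep_odd[OF f AE_I2[OF impI[OF refl]]]
  have conv_FT: "FT (\<lambda>x. F x + c * conv F (even_ext b) x) y = FT F y * (1 + fourier_cos \<phi> y)"
    and conv_int: "integrable lborel (\<lambda>x. F x + c * conv F (even_ext b) x)" if "integrable lborel F" for F y
  proof -
    note i = integrable_conv[OF that integrable_even_ext[OF bi]]
    show "FT (\<lambda>x. F x + c * conv F (even_ext b) x) y = FT F y * (1 + fourier_cos \<phi> y)"
      using that i by (simp add: FT_add FT_cmult FT_conv integrable_even_ext bi cos_b algebra_simps)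
    show "integrable lborel (\<lambda>x. F x + c * conv F (even_ext b) x)" using that i by simp
  qed
  have "AE x in lborel. f x + c * conv f (even_ext b) x = p x"
    by (rule FT_unique[OF conv_int[OF f(1)] p(1)]) (simp add: conv_FT[OF f(1)] FT_eq)
  with sneddon_conv_AE[OF rep_f(1) b]
  have "AE x in lborel. x > 0 \<longrightarrow> f x + sneddon_conv f \<phi> x = p x"
    unfolding rep_f(2) c_def[symmetric] by eventually_elim simp
  then have sol: "L1_solution \<xi> \<phi> h f"
    using rep_f(1) by (auto simp: L1_solution_def L1_iff_half_line_rep p_def AE_completion_iff)
  have uniq: "AE x in lebesgue. x > 0 \<longrightarrow> g x = f x" if "L1_solution \<xi> \<phi> h g" for g
  proof -
    have "g \<in> L1" using that by (simp add: L1_solution_def)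
    then obtain g' where g': "half_line_rep g g'" unfolding L1_iff_half_line_rep by blast
    let ?G = "odd_ext g'"
    have g'i: "integrable lborel g'" and g'0: "\<And>x. x \<le> 0 \<Longrightarrow> g' x = 0" and gg': "AE x in lborel. x > 0 \<longrightarrow> g x = g' x"
      using g' by (auto simp: half_line_rep_def)
    have G: "integrable lborel ?G" by (rule integrable_odd_ext[OF g'i])
    have "AE x in lborel. x > 0 \<longrightarrow> g x + sneddon_conv g \<phi> x = p x"
      using that by (simp add: L1_solution_def AE_completion_iff p_def)
    with sneddon_conv_AE[OF g' b] gg'
    have AE: "AE x in lborel. x > 0 \<longrightarrow> ?G x + c * conv ?G (even_ext b) x = p x"
      unfolding c_def[symmetric]
    proof eventually_elim
      case (elim x)
      have "g' (- x) = 0" if "x > 0" using g'0[of "- x"] that by simp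
      with elim show ?case by (auto simp: odd_ext_def)
    qed
    have "FT ?G y * (1 + fourier_cos \<phi> y) = FT f y * (1 + fourier_cos \<phi> y)" for y
      unfolding FT_eq conv_FT[OF G, symmetric]
      by (rule FT_eq_of_odd_eq_on_half_line[OF conv_int[OF G] p(1) _ p(2) AE])
         (simp add: odd_ext_odd conv_odd_even even_ext_even)
    with l(3) have "FT ?G y = FT f y" for y by simp
    then have "AE x in lborel. ?G x = f x" by (intro FT_unique G f(1))
    with gg' have "AE x in lborel. x > 0 \<longrightarrow> g x = f x"
    proof eventually_elim
      case (elim x)
      have "g' (- x) = 0" if "x > 0" using g'0[of "- x"] that by simp
      with elim show ?case by (auto simp: odd_ext_def)
    qed
    then show ?thesis by (simp add: AE_completion_iff)
  qed
  let ?S = "\<lambda>x. c * conv (odd_ext a) (even_ext l) x"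
  have S: "integrable lborel ?S" "\<And>x. ?S (- x) = - ?S x"
    using integrable_conv[OF integrable_odd_ext[OF ai] integrable_even_ext[OF li]]
    by (auto simp: conv_odd_even odd_ext_odd even_ext_even)
  note rep_S = half_line_rep_odd[OF S sneddon_conv_AE[OF a l(1), folded c_def]]
  \<comment> \<open>Sneddon's convolution contributes \<open>c\<close>, the second convolution \<open>1 / 2\<close>, the polyconvolution \<open>c / 2\<close>.\<close>
  have "FT (yb_conv (sneddon_conv \<xi> l) h) y = FT f y" for y
    unfolding FT_yb_conv[OF rep_S(1) H(1)] rep_S(2) FT_f FT_cmult
    by (simp add: FT_conv integrable_odd_ext integrable_even_ext ai li)
  then have "AE x in lborel. yb_conv (sneddon_conv \<xi> l) h x = f x"
    by (intro FT_unique integrable_yb_conv[OF rep_S(1) H(1)] f(1))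
  then have yb: "AE x in lebesgue. x > 0 \<longrightarrow> f x = yb_conv (sneddon_conv \<xi> l) h x"
    unfolding AE_completion_iff by eventually_elim simp
  have "L1_norm f = (\<integral>x. indicator {0..} x * norm (f x) \<partial>lborel)"
  proof -
    have "L1_norm f = (\<integral>x. norm (if x > 0 then f x else 0) \<partial>lborel)"
      by (rule L1_norm_half_line_rep[OF rep_f(1)])
    also have "\<dots> = (\<integral>x. indicator {0..} x * norm (f x) \<partial>lborel)"
    proof (intro Bochner_Integration.integral_cong refl)
      have "f 0 = 0" using f(2)[of 0] by simp
      then show "norm (if x > 0 then f x else 0) = indicator {0..} x * norm (f x)" for x
        by (auto split: split_indicator simp: not_less order.order_iff_strict)
    qed
    finally show ?thesis .
  qed
  also have "\<dots> = (\<integral>x. norm (f x) \<partial>lborel) / 2"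
    by (rule integral_even_half_line) (use f in auto)
  also have "\<dots> \<le> sqrt (2 / pi) * (L1_norm \<xi> * (L1_norm l * (\<integral>w. norm (H w) * K0 w \<partial>lborel)))"
    using polyconv_norm_le[OF a l(1) H(1)]
    unfolding f_def L1_norm_half_line_rep[OF a] L1_norm_half_line_rep[OF l(1)] by simp
  also have "\<dots> \<le> sqrt (2 / pi) * (L1_norm \<xi> * (L1_norm l * L1_weighted_norm \<beta> h))"
    using H(2) unfolding L1_norm_half_line_rep[OF a] L1_norm_half_line_rep[OF l(1)]
    by (intro mult_left_mono) auto
  finally have norm: "L1_norm f \<le> sqrt (2 / pi) * L1_norm \<xi> * L1_norm l * L1_weighted_norm \<beta> h"
    by (simp add: mult.assoc)
  have l1: "l \<in> L1" using l(1) L1_iff_half_line_rep by blast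
  have l_uniq: "AE x in lebesgue. x > 0 \<longrightarrow> m x = l x"
    if "m \<in> L1" "\<forall>y>0. fourier_cos m y = fourier_cos \<phi> y / (1 + fourier_cos \<phi> y)" for m
    unfolding AE_completion_iff by (rule fourier_cos_injective[OF that(1) l1]) (use that(2) l(2) in simp)
  show ?thesis
    using sol uniq l1 l(2) l_uniq yb norm
    by (intro exI[of _ f] exI[of _ l]) (auto simp: f_def)
qed

end
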